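(* Let $\mathcal T$ be a self-similar tiling in $\mathbb R^d$ with (single) generator $G\subseteq\mathbb R^d$ of inradius $g$, and suppose a Steiner-like representation $V(G,\varepsilon)=\sum_{k=0}^d\kappa_k(G,\varepsilon)\varepsilon^{d-k}$ ($0<\varepsilon\le g$) has been chosen for $G$. Assume that the poles of the tubular zeta function $\zeta_{\mathcal T}$ are simple (which implies that $\mathcal D_{\mathcal L}$ and $\{0,1,\dots,d\}$ are disjoint). Then for all $0<\varepsilon<g$, $$V(\mathcal T,\varepsilon)=\sum_{\omega\in\mathcal D_{\mathcal L}}c_\omega\varepsilon^{d-\omega}+\sum_{k=0}^d\bigl(c_k+e_k(\varepsilon)\bigr)\varepsilon^{d-k},$$ where $$c_\omega:=\frac{\operatorname{Res}_{s=\omega}\zeta_{\mathcal L}(s)}{d-\omega}\sum_{k=0}^{d-1}\frac{g^{\omega-k}(d-k)}{\omega-k}\kappa_k(G)\quad(\omega\in\mathcal D_{\mathcal L}),$$ and, for $k\in\{0,1,\dots,d\}$, $$c_k:=\kappa_k(G)\,\zeta_{\mathcal L}(k),\qquad e_k(\varepsilon):=\sum_{j=1}^{J(\varepsilon)}\ell_j^k\bigl(\kappa_k(G,\ell_j^{-1}\varepsilon)-\kappa_k(G)\bigr),$$ with $J(\varepsilon):=\max\bigl(\{j\ge1:\ell_j^{-1}\varepsilon<g\}\cup\{0\}\bigr)$. Equivalently, $V(\mathcal T,\varepsilon)=\sum_{\omega\in\mathcal D_{\mathcal L}}c_\omega\varepsilon^{d-\omega}+\sum_{k=0}^dc_k(\varepsilon)\varepsilon^{d-k}$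 with $c_k(\varepsilon):=c_k+e_k(\varepsilon)$.
   Context: Self-similar tilings. Let $\{\Phi_1,\dots,\Phi_N\}$, $N\ge2$, be contractive similarities of $\mathbb R^d$ with scaling ratios $r_n\in(0,1)$, $\Phi(A):=\bigcup_n\Phi_n(A)$, and $F$ the attractor (the unique nonempty compact set with $F=\Phi(F)$). A feasible open set is a nonempty open $O\subseteq\mathbb R^d$ (bounded here) with $\Phi_n(O)\subseteq O$ for all $n$ and $\Phi_n(O)\cap\Phi_m(O)=\emptyset$ for $n\ne m$; the open set condition says that one exists. The nontriviality condition says that $O\not\subseteq\Phi(\overline O)$ for some feasible $O$ (this does not depend on the choice of $O$). Both conditions are always assumed. The self-similar tiling associated with $\{\Phi_n\}$ and $O$ is $\mathcal T=\{\Phi_w(G_q)\}$, where the $G_q$ are the connected components of $O\setminus\Phi(\overline O)$ and $w=w_1\cdots w_n$ runs over all finite words (including the empty word) in $\{1,\dots,N\}$, with $\Phi_w=\Phi_{w_1}\circ\cdots\circ\Phi_{w_n}$, $r_w=r_{w_1}\cdots r_{w_n}$ ($\Phi_w=\mathrm{Id}$, $r_w=1$ for the empty word). Here there is a single component $G$ (the generator). The words are ordered as $w^{(1)},w^{(2)},\dots$ so that $\ell_j:=r_{w^{(j)}}$ is nonincreasing; $\mathcal L=\{\ell_j\}$ is the associated fractal string ($\ell_1=1$), and the tiles are $G^j=\Phi_{w^{(j)}}(G)$. Inner parallel volumes. $\lambda_d$ is Lebesgue measure. For bounded open $A\subseteq\mathbb R^d$ and $\varepsilon>0$, $A_{-\varepsilon}:=\{x\in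 A:\operatorname{dist}(x,A^c)\le\varepsilon\}$, $V(A,\varepsilon):=\lambda_d(A_{-\varepsilon})$, and $V(\mathcal T,\varepsilon):=\lambda_d(T_{-\varepsilon})=\sum_jV(G^j,\varepsilon)$ with $T=\bigcup_jG^j$. The inradius $g$ of $G$ is the radius of the largest open ball contained in $G$. Steiner-like representation. This is an expression $V(G,\varepsilon)=\sum_{k=0}^d\kappa_k(G,\varepsilon)\varepsilon^{d-k}$ for $0<\varepsilon\le g$, where each $\kappa_k(G,\cdot)$ is a real-valued function on $(0,g]$ bounded on $[\varepsilon_0,g]$ for every $\varepsilon_0\in(0,g]$. Put $\kappa_k(G):=\kappa_k(G,g)$ and extend by $\kappa_k(G,\varepsilon):=\kappa_k(G)$ for $\varepsilon\ge g$. Zeta functions. $\zeta_{\mathcal L}(s)=\sum_j\ell_j^s$ for $\Re s$ large, with meromorphic continuation $\zeta_{\mathcal L}(s)=1/(1-\sum_{n=1}^Nr_n^s)$ to $\mathbb C$. The tubular zeta function is (the meromorphic extension in $s$ to $\mathbb C$ of) $$\zeta_{\mathcal T}(\varepsilon,s)=\varepsilon^{d-s}\sum_{j=1}^\infty\ell_j^s\left(\sum_{k=0}^d\frac{g^{s-k}}{s-k}\kappa_k(G,\ell_j^{-1}\varepsilon)-\frac{g^{s-d}}{s-d}\lambda_d(G)\right).$$ $\mathcal D_{\mathcal L}$ is the set of poles of $\zeta_{\mathcal L}$ (the complex roots of $\sum_nr_n^s=1$). The set of (potential) poles of $\zeta_{\mathcal T}$ is $\mathcal D_{\mathcal T}:=\mathcal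 D_{\mathcal L}\cup\{0,1,\dots,d\}$; "the poles of $\zeta_{\mathcal T}$ are simple" is understood to mean that all poles of $\zeta_{\mathcal L}$ are simple and $\mathcal D_{\mathcal L}\cap\{0,1,\dots,d\}=\emptyset$. Convention. An infinite sum over complex dimensions is understood as $\lim_{n\to\infty}$ of the sums over those $\omega$ with $T_{-n}<\Im\omega<T_n$, where $\{T_n\}_{n\in\mathbb Z}$ is a real sequence with $T_{-n}<0<T_n$ ($n\ge1$), $T_n\to\infty$, $T_{-n}\to-\infty$, $T_n/|T_{-n}|\to1$, along which $\zeta_{\mathcal L}$ is languid of order $0$: for some $c>0$, $|\zeta_{\mathcal L}(\alpha+iT_n)|\le c$ for all $n$ and all $\alpha\in\mathbb R$ (such sequences exist for self-similar strings). *)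

theory Defs
  imports "HOL-Complex_Analysis.Complex_Analysis"
begin

section \<open>Iterated function systems and self-similar tilings\<close>

definition contractive_similarity :: "('a::metric_space \<Rightarrow> 'a) \<Rightarrow> real \<Rightarrow> bool" where
  "contractive_similarity f r \<longleftrightarrow> 0 < r \<and> r < 1 \<and> (\<forall>x y. dist (f x) (f y) = r * dist x y)"

definition similarity_system :: "nat \<Rightarrow> (nat \<Rightarrow> 'a::metric_space \<Rightarrow> 'a) \<Rightarrow> (nat \<Rightarrow> real) \<Rightarrow> bool" where
  "similarity_system N \<Phi> r \<longleftrightarrow> N \<ge> 2 \<and> (\<forall>n\<in>{1..N}. contractive_similarity (\<Phi> n) (r n))"

definition set_map :: "nat \<Rightarrow> (nat \<Rightarrow> 'a \<Rightarrow> 'a) \<Rightarrow> 'a set \<Rightarrow> 'a set" where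
  "set_map N \<Phi> A = (\<Union>n\<in>{1..N}. \<Phi> n ` A)"

definition feasible_open_set :: "nat \<Rightarrow> (nat \<Rightarrow> 'a::metric_space \<Rightarrow> 'a) \<Rightarrow> 'a set \<Rightarrow> bool" where
  "feasible_open_set N \<Phi> U \<longleftrightarrow> U \<noteq> {} \<and> open U \<and> bounded U \<and>
     (\<forall>n\<in>{1..N}. \<Phi> n ` U \<subseteq> U) \<and>
     (\<forall>n\<in>{1..N}. \<forall>m\<in>{1..N}. n \<noteq> m \<longrightarrow> \<Phi> n ` U \<inter> \<Phi> m ` U = {})"

definition nontrivial_system :: "nat \<Rightarrow> (nat \<Rightarrow> 'a::metric_space \<Rightarrow> 'a) \<Rightarrow> bool" where
  "nontrivial_system N \<Phi> \<longleftrightarrow>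
     (\<exists>U. feasible_open_set N \<Phi> U \<and> \<not> U \<subseteq> set_map N \<Phi> (closure U))"

text \<open>Finite words over the alphabet are lists; the empty word is allowed.\<close>

definition word_map :: "(nat \<Rightarrow> 'a \<Rightarrow> 'a) \<Rightarrow> nat list \<Rightarrow> 'a \<Rightarrow> 'a" where
  "word_map \<Phi> w = foldr (\<lambda>n f. \<Phi> n \<circ> f) w id"

definition word_ratio :: "(nat \<Rightarrow> real) \<Rightarrow> nat list \<Rightarrow> real" where
  "word_ratio r w = prod_list (map r w)"

definition generators :: "nat \<Rightarrow> (nat \<Rightarrow> 'a::metric_space \<Rightarrow> 'a) \<Rightarrow> 'a set \<Rightarrow> 'a set set" where
  "generators N \<Phi> U = components (U - set_map N \<Phi> (closure U))"

definition self_similar_tiling ::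
    "nat \<Rightarrow> (nat \<Rightarrow> 'a::metric_space \<Rightarrow> 'a) \<Rightarrow> 'a set \<Rightarrow> 'a set set" where
  "self_similar_tiling N \<Phi> U =
     {word_map \<Phi> w ` G | w G. w \<in> lists {1..N} \<and> G \<in> generators N \<Phi> U}"

text \<open>An enumeration \<open>W 1, W 2, \<dots>\<close> of all words (the value \<open>W 0\<close> is irrelevant) with
  nonincreasing ratios, and the fractal string of these ratios.\<close>

definition word_string :: "(nat \<Rightarrow> real) \<Rightarrow> (nat \<Rightarrow> nat list) \<Rightarrow> nat \<Rightarrow> real" where
  "word_string r W j = word_ratio r (W j)"

definition word_ordering :: "nat \<Rightarrow> (nat \<Rightarrow> real) \<Rightarrow> (nat \<Rightarrow> nat list) \<Rightarrow> bool" where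
  "word_ordering N r W \<longleftrightarrow>
     bij_betw W {1..} (lists {1..N}) \<and> antimono_on {1..} (word_string r W)"


section \<open>Inner parallel volumes and Steiner-like representations\<close>

definition inner_parallel_set :: "'a::euclidean_space set \<Rightarrow> real \<Rightarrow> 'a set" where
  "inner_parallel_set A \<epsilon> = {x \<in> A. infdist x (- A) \<le> \<epsilon>}"

definition inner_volume :: "'a::euclidean_space set \<Rightarrow> real \<Rightarrow> real" where
  "inner_volume A \<epsilon> = measure lebesgue (inner_parallel_set A \<epsilon>)"

definition tiling_inner_volume :: "'a::euclidean_space set set \<Rightarrow> real \<Rightarrow> real" where
  "tiling_inner_volume \<T> \<epsilon> = inner_volume (\<Union>\<T>) \<epsilon>"

definition inradius :: "'a::euclidean_space set \<Rightarrow> real" where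
  "inradius A = Sup {\<rho>. 0 < \<rho> \<and> (\<exists>x. ball x \<rho> \<subseteq> A)}"

text \<open>Only the values of \<open>\<kappa> k\<close> on \<open>(0, inradius G]\<close>, \<open>k \<le> d\<close>, are relevant.\<close>

definition steiner_like :: "'a::euclidean_space set \<Rightarrow> (nat \<Rightarrow> real \<Rightarrow> real) \<Rightarrow> bool" where
  "steiner_like G \<kappa> \<longleftrightarrow>
     (\<forall>\<epsilon>. 0 < \<epsilon> \<and> \<epsilon> \<le> inradius G \<longrightarrow>
        inner_volume G \<epsilon> = (\<Sum>k=0..DIM('a). \<kappa> k \<epsilon> * \<epsilon> ^ (DIM('a) - k))) \<and>
     (\<forall>k\<in>{0..DIM('a)}. \<forall>\<epsilon>\<^sub>0\<in>{0<..inradius G}. bounded (\<kappa> k ` {\<epsilon>\<^sub>0..inradius G}))"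

definition coeff_extended :: "real \<Rightarrow> (nat \<Rightarrow> real \<Rightarrow> real) \<Rightarrow> nat \<Rightarrow> real \<Rightarrow> real" where
  "coeff_extended g \<kappa> k \<epsilon> = (if \<epsilon> < g then \<kappa> k \<epsilon> else \<kappa> k g)"


section \<open>The zeta function of the string and its complex dimensions\<close>

text \<open>The meromorphic continuation to the whole plane of the Dirichlet series
  \<open>\<Sum>j\<ge>1. l j powr s\<close>.  The predicate \<open>nicely_meromorphic_on\<close> excludes removable
  singularities and fixes the value at a pole to be \<open>0\<close>, which makes the continuation unique.
  For the string of a similarity system it is \<open>1 / (1 - (\<Sum>n=1..N. r n powr s))\<close>.\<close>

definition string_zeta :: "(nat \<Rightarrow> real) \<Rightarrow> complex \<Rightarrow> complex" where
  "string_zeta l = (THE \<zeta>. \<zeta> nicely_meromorphic_on UNIV \<and>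
     (\<exists>\<sigma>. \<forall>s. Re s > \<sigma> \<longrightarrow> ((\<lambda>j. complex_of_real (l j) powr s) has_sum \<zeta> s) {1..}))"

definition complex_dims :: "(nat \<Rightarrow> real) \<Rightarrow> complex set" where
  "complex_dims l = {\<omega>. is_pole (string_zeta l) \<omega>}"

text \<open>The tubular zeta function of a tiling with generator \<open>G\<close> of inradius \<open>g\<close> in
  dimension \<open>d\<close> is the continuation in \<open>s\<close> of \<open>\<epsilon> powr (d - s)\<close> times
  \<open>\<Sum>j\<ge>1. l j powr s * ((\<Sum>k\<le>d. g powr (s - k) / (s - k) * \<kappa> k (\<epsilon> / l j)) - g powr (s - d) / (s - d) * vol G)\<close>.
  Its (potential) poles are by definition \<open>complex_dims l \<union> {0, \<dots>, d}\<close>, whether or not a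
  cancellation occurs, and they are called simple if all poles of the zeta function of the
  string are simple and none of them lies in \<open>{0, \<dots>, d}\<close>.\<close>

definition tubular_poles_simple :: "nat \<Rightarrow> (nat \<Rightarrow> real) \<Rightarrow> bool" where
  "tubular_poles_simple d l \<longleftrightarrow>
     (\<forall>\<omega>\<in>complex_dims l. zorder (string_zeta l) \<omega> = -1) \<and>
     complex_dims l \<inter> of_nat ` {0..d} = {}"

definition languid_sequence :: "(nat \<Rightarrow> real) \<Rightarrow> (int \<Rightarrow> real) \<Rightarrow> bool" where
  "languid_sequence l T \<longleftrightarrow>
     (\<forall>n\<ge>1. T (- n) < 0 \<and> 0 < T n) \<and>
     filterlim T at_top at_top \<and> filterlim T at_bot at_bot \<and>
     ((\<lambda>n. T n / \<bar>T (- n)\<bar>) \<longlongrightarrow> 1) at_top \<and>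
     (\<exists>c>0. \<forall>n. \<forall>\<alpha>::real. norm (string_zeta l (Complex \<alpha> (T n))) \<le> c)"

text \<open>The sum over the complex dimensions, as the limit of the (finite) sums over those
  in the horizontal strips cut out by \<open>T\<close>.\<close>

definition dims_sum_to ::
    "(nat \<Rightarrow> real) \<Rightarrow> (int \<Rightarrow> real) \<Rightarrow> (complex \<Rightarrow> complex) \<Rightarrow> complex \<Rightarrow> bool" where
  "dims_sum_to l T f S \<longleftrightarrow>
     (\<lambda>n::nat. \<Sum>\<omega> | \<omega> \<in> complex_dims l \<and> T (- int n) < Im \<omega> \<and> Im \<omega> < T (int n). f \<omega>)
       \<longlonglongrightarrow> S"


section \<open>The coefficients of the tube formula\<close>

text \<open>Here \<open>d\<close> is the dimension, \<open>g\<close> the inradius of the generator, \<open>l\<close> the string and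
  \<open>\<kappa>\<close> the coefficients of the Steiner-like representation.\<close>

definition coeff_dim ::
    "nat \<Rightarrow> real \<Rightarrow> (nat \<Rightarrow> real) \<Rightarrow> (nat \<Rightarrow> real \<Rightarrow> real) \<Rightarrow> complex \<Rightarrow> complex" where
  "coeff_dim d g l \<kappa> \<omega> =
     residue (string_zeta l) \<omega> / (of_nat d - \<omega>) *
     (\<Sum>k<d. complex_of_real g powr (\<omega> - of_nat k) * of_nat (d - k) / (\<omega> - of_nat k)
               * of_real (\<kappa> k g))"

definition coeff_int ::
    "real \<Rightarrow> (nat \<Rightarrow> real) \<Rightarrow> (nat \<Rightarrow> real \<Rightarrow> real) \<Rightarrow> nat \<Rightarrow> complex" where
  "coeff_int g l \<kappa> k = of_real (\<kappa> k g) * string_zeta l (of_nat k)"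

definition last_large :: "real \<Rightarrow> (nat \<Rightarrow> real) \<Rightarrow> real \<Rightarrow> nat" where
  "last_large g l \<epsilon> = Max ({j. 1 \<le> j \<and> inverse (l j) * \<epsilon> < g} \<union> {0})"

definition coeff_err ::
    "real \<Rightarrow> (nat \<Rightarrow> real) \<Rightarrow> (nat \<Rightarrow> real \<Rightarrow> real) \<Rightarrow> nat \<Rightarrow> real \<Rightarrow> real" where
  "coeff_err g l \<kappa> k \<epsilon> =
     (\<Sum>j=1..last_large g l \<epsilon>.
        l j ^ k * (coeff_extended g \<kappa> k (inverse (l j) * \<epsilon>) - \<kappa> k g))"

definition coeff_total ::
    "real \<Rightarrow> (nat \<Rightarrow> real) \<Rightarrow> (nat \<Rightarrow> real \<Rightarrow> real) \<Rightarrow> nat \<Rightarrow> real \<Rightarrow> complex" where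
  "coeff_total g l \<kappa> k \<epsilon> = coeff_int g l \<kappa> k + of_real (coeff_err g l \<kappa> k \<epsilon>)"

end

theory Submission
  imports Defs
begin

text \<open>
  Write \<open>d\<close> for the dimension, \<open>x = \<epsilon> / g < 1\<close>, and \<open>\<zeta> s = 1 / (1 - (\<Sum>n=1..N. r n powr s))\<close> for the zeta
  function of the string.

  The tiles are disjoint open sets, so the distance of a point of a tile to the complement of
  their union equals its distance to the complement of the tile.  Since similarities scale volume,
  the inner parallel volume of the tiling is the sum over \<open>j\<close> of \<open>l j ^ d * V(G, \<epsilon> / l j)\<close>
  (\<open>tiling_volume_sums\<close>).  For \<open>l j > x\<close>, which means \<open>j \<le> J = last_large g l \<epsilon>\<close>, the Steiner-like
  representation applies; for \<open>l j \<le> x\<close> the inner parallel set is the whole tile.  Expanding, and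
  cancelling the terms with \<open>coeff_int\<close> and \<open>coeff_err\<close>, one is left with the claim that the sum over the
  complex dimensions is
  \<open>(\<Sum>k\<le>d. \<kappa> k g * (g ^ (d - k) * D d - \<epsilon> ^ (d - k) * D k))\<close>, where
  \<open>D s = \<zeta> s - (\<Sum>j\<le>J. l j powr s)\<close>.  In particular \<open>D d\<close> is the tail of the series.

  This is linear in the \<open>\<kappa> k g\<close>, and for each \<open>k < d\<close> it is a statement about the residues of
  \<open>D s * x powr (- s) / ((s - k) * (d - s))\<close>.  Removing the first \<open>J\<close> terms of the series makes
  \<open>D s * x powr (- s)\<close> bounded for large \<open>\<bar>Re s\<bar>\<close> on both sides and along the lines \<open>Im s = T n\<close>, so its
  integral over the boundary of large rectangles tends to \<open>0\<close> (\<open>residue_sum_tendsto\<close>).  The residues at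
  the complex dimensions therefore sum to the negative of those at \<open>k\<close> and \<open>d\<close>, which are the two terms
  above (\<open>complex_dims_sum_tendsto\<close>).

  The convergence of the series for \<open>Re s \<ge> d\<close> comes from the finite total volume of the tiles, and
  its value \<open>\<zeta> s\<close> from the renewal equation for sums over words (\<open>word_ratio_renewal\<close>).
\<close>

section \<open>Similarities and Lebesgue measure\<close>

text \<open>A map that multiplies all distances by the fixed factor \<open>\<rho> > 0\<close>.  The factor need not be less
  than \<open>1\<close>, so that the identity, which is the map of the empty word, is included.\<close>

definition similarity :: "('a::metric_space \<Rightarrow> 'a) \<Rightarrow> real \<Rightarrow> bool" where
  "similarity f \<rho> \<longleftrightarrow> 0 < \<rho> \<and> (\<forall>x y. dist (f x) (f y) = \<rho> * dist x y)"

lemma similarity_surj: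
  fixes f :: "'a::euclidean_space \<Rightarrow> 'a"
  assumes "similarity f \<rho>"
  shows "surj f"
proof -
  have \<rho>: "\<rho> > 0" and d: "dist (f x) (f y) = \<rho> * dist x y" for x y
    using assms by (auto simp: similarity_def)
  define h where "h x = (1 / \<rho>) *\<^sub>R (f x - f 0)" for x
  have "dist (h x) (h y) = dist x y" for x y
  proof -
    have "h x - h y = (1 / \<rho>) *\<^sub>R (f x - f y)"
      by (simp add: h_def algebra_simps)
    then show ?thesis
      using \<rho> d[of x y] by (simp add: dist_norm)
  qed
  then have "orthogonal_transformation h"
    by (simp add: orthogonal_transformation_isometry h_def)
  then have "surj h" by (rule orthogonal_transformation_surj)
  show ?thesis
  proof (rule surjI)
    fix y
    have "h (inv h ((1 / \<rho>) *\<^sub>R (y - f 0))) = (1 / \<rho>) *\<^sub>R (y - f 0)"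
      using \<open>surj h\<close> by (rule surj_f_inv_f)
    then show "f (inv h ((1 / \<rho>) *\<^sub>R (y - f 0))) = y"
      using \<rho> by (simp add: h_def)
  qed
qed

lemma similarity_inj: "similarity f \<rho> \<Longrightarrow> inj f"
  unfolding similarity_def inj_def by (metis dist_eq_0_iff mult_eq_0_iff less_irrefl)

lemma similarity_bij:
  fixes f :: "'a::euclidean_space \<Rightarrow> 'a"
  shows "similarity f \<rho> \<Longrightarrow> bij f"
  by (simp add: bij_def similarity_surj similarity_inj)

lemma similarity_image_ball:
  fixes f :: "'a::euclidean_space \<Rightarrow> 'a"
  assumes "similarity f \<rho>"
  shows "f ` ball x \<delta> = ball (f x) (\<rho> * \<delta>)"
proof -
  have \<rho>: "\<rho> > 0" and d: "dist (f x) (f y) = \<rho> * dist x y" for x y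
    using assms by (auto simp: similarity_def)
  have "y \<in> f ` ball x \<delta>" if "y \<in> ball (f x) (\<rho> * \<delta>)" for y
  proof -
    obtain z where "y = f z" using similarity_surj[OF assms] by auto
    with that show ?thesis using \<rho> by (auto simp: d)
  qed
  then show ?thesis using \<rho> by (auto simp: d)
qed

lemma similarity_image_open:
  fixes f :: "'a::euclidean_space \<Rightarrow> 'a"
  assumes "similarity f \<rho>" "open A"
  shows "open (f ` A)"
  unfolding open_contains_ball
proof (intro ballI)
  fix y assume "y \<in> f ` A"
  then obtain x where x: "x \<in> A" "y = f x" by auto
  then obtain e where "e > 0" "ball x e \<subseteq> A" using assms(2) open_contains_ball by blast
  then have "ball y (\<rho> * e) \<subseteq> f ` A" "\<rho> * e > 0"
    using similarity_image_ball[OF assms(1), of x e] assms(1) x(2) image_mono[of "ball x e" A f]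
    by (simp_all add: similarity_def)
  then show "\<exists>e>0. ball y e \<subseteq> f ` A" by blast
qed

text \<open>By Vitali's theorem an open set is a countable disjoint union of balls up to a null set.  A
  similarity maps balls to balls and, being Lipschitz, null sets to null sets; so the scaling of the
  volume of balls gives that of all open sets.\<close>

lemma emeasure_similarity_image_open:
  fixes f :: "'a::euclidean_space \<Rightarrow> 'a"
  assumes f: "similarity f \<rho>" and A: "open A"
  shows "emeasure lebesgue (f ` A) = ennreal (\<rho> ^ DIM('a)) * emeasure lebesgue A"
proof -
  have \<rho>: "\<rho> > 0" and d: "dist (f x) (f y) = \<rho> * dist x y" for x y
    using f by (auto simp: similarity_def)
  define K where "K = {(a, \<delta>). 0 < \<delta> \<and> ball a \<delta> \<subseteq> A}"
  have cover: "\<exists>i. i \<in> K \<and> x \<in> ball (fst i) (snd i) \<and> snd i < e" if "x \<in> A" "0 < e" for x e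
  proof -
    obtain \<delta> where "\<delta> > 0" "ball x \<delta> \<subseteq> A" using A \<open>x \<in> A\<close> open_contains_ball by blast
    then show ?thesis using \<open>0 < e\<close>
      by (intro exI[of _ "(x, min \<delta> (e/2))"]) (auto simp: K_def)
  qed
  obtain C where C: "countable C" "C \<subseteq> K"
     and pw: "pairwise (\<lambda>i j. disjnt (ball (fst i) (snd i)) (ball (fst j) (snd j))) C"
     and neg: "negligible (A - (\<Union>i\<in>C. ball (fst i) (snd i)))"
    by (rule Vitali_covering_theorem_balls[of A K fst snd, OF cover])
  define B where "B i = ball (fst i) (snd i)" for i :: "'a \<times> real"
  \<comment> \<open>Lipschitz maps preserve null sets.\<close>
  have negim: "negligible (f ` (A - (\<Union>i\<in>C. B i)))"
  proof (rule negligible_locally_Lipschitz_image)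
    show "negligible (A - (\<Union>i\<in>C. B i))" using neg by (simp add: B_def)
    fix x
    show "\<exists>T M. open T \<and> x \<in> T \<and>
        (\<forall>y\<in>(A - \<Union> (B ` C)) \<inter> T. norm (f y - f x) \<le> M * norm (y - x))"
      using d by (intro exI[of _ UNIV] exI[of _ \<rho>]) (auto simp: dist_norm)
  qed simp
  have disj: "disjoint_family_on B C"
    using pw by (auto simp: disjoint_family_on_def pairwise_def disjnt_def B_def)
  have disjf: "disjoint_family_on (\<lambda>i. f ` B i) C"
    using disj similarity_inj[OF f] unfolding disjoint_family_on_def
    by (metis image_Int image_empty)
  have fB: "emeasure lebesgue (f ` B i) = ennreal (\<rho> ^ DIM('a)) * emeasure lebesgue (B i)"
    if "i \<in> C" for i
  proof -
    have "snd i > 0" using that C(2) by (auto simp: K_def)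
    then show ?thesis using \<rho>
      unfolding B_def similarity_image_ball[OF f]
      by (simp add: emeasure_ball ennreal_mult[symmetric] power_mult_distrib mult_ac)
  qed
  have sub: "(\<Union>i\<in>C. B i) \<subseteq> A" using C(2) by (fastforce simp: B_def K_def)
  have eqA: "emeasure lebesgue A = (\<integral>\<^sup>+i. emeasure lebesgue (B i) \<partial>count_space C)"
  proof -
    have "A = (\<Union>i\<in>C. B i) \<union> (A - (\<Union>i\<in>C. B i))" using sub by auto
    then have "emeasure lebesgue A = emeasure lebesgue ((\<Union>i\<in>C. B i) \<union> (A - (\<Union>i\<in>C. B i)))"
      by simp
    also have "\<dots> = emeasure lebesgue (\<Union>i\<in>C. B i)"
      using neg C(1) by (intro emeasure_Un_null_set) (auto simp: negligible_iff_null_sets B_def)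
    also have "\<dots> = (\<integral>\<^sup>+i. emeasure lebesgue (B i) \<partial>count_space C)"
      using C(1) disj by (intro emeasure_UN_countable) (auto simp: B_def[abs_def])
    finally show ?thesis .
  qed
  have "f ` A = (\<Union>i\<in>C. f ` B i) \<union> f ` (A - (\<Union>i\<in>C. B i))"
    unfolding image_UN[symmetric] image_Un[symmetric] using sub by (simp add: Un_absorb1)
  then have "emeasure lebesgue (f ` A)
      = emeasure lebesgue ((\<Union>i\<in>C. f ` B i) \<union> f ` (A - (\<Union>i\<in>C. B i)))"
    by simp
  also have "\<dots> = emeasure lebesgue (\<Union>i\<in>C. f ` B i)"
    using negim C(1)
    by (intro emeasure_Un_null_set) (auto simp: negligible_iff_null_sets B_def similarity_image_ball[OF f])
  also have "\<dots> = (\<integral>\<^sup>+i. emeasure lebesgue (f ` B i) \<partial>count_space C)"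
    using C(1) disjf
    by (intro emeasure_UN_countable) (auto simp: B_def similarity_image_ball[OF f])
  also have "\<dots> = (\<integral>\<^sup>+i. ennreal (\<rho> ^ DIM('a)) * emeasure lebesgue (B i) \<partial>count_space C)"
    by (intro nn_integral_cong) (simp add: fB)
  also have "\<dots> = ennreal (\<rho> ^ DIM('a)) * emeasure lebesgue A"
    unfolding eqA by (rule nn_integral_cmult) simp
  finally show ?thesis .
qed

lemma measure_similarity_image_open:
  fixes f :: "'a::euclidean_space \<Rightarrow> 'a"
  assumes f: "similarity f \<rho>" and A: "open A"
  shows "measure lebesgue (f ` A) = \<rho> ^ DIM('a) * measure lebesgue A"
  using emeasure_similarity_image_open[OF assms] f
  by (simp add: measure_def enn2real_mult similarity_def)

lemma similarity_image_Compl: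
  fixes f :: "'a::euclidean_space \<Rightarrow> 'a"
  assumes "similarity f \<rho>"
  shows "- f ` A = f ` (- A)"
  using bij_image_Compl_eq[OF similarity_bij[OF assms]] by simp

lemma infdist_similarity_image:
  fixes f :: "'a::euclidean_space \<Rightarrow> 'a"
  assumes "similarity f \<rho>"
  shows "infdist (f x) (f ` B) = \<rho> * infdist x B"
proof (cases "B = {}")
  case False
  have \<rho>: "\<rho> > 0" and d: "dist (f x) (f y) = \<rho> * dist x y" for x y
    using assms by (auto simp: similarity_def)
  have "\<rho> * infdist x B \<le> infdist (f x) (f ` B)"
    unfolding infdist_notempty[of "f ` B", simplified, OF False] image_image
    using False \<rho> by (intro cINF_greatest) (auto simp: d infdist_le)
  moreover have "infdist (f x) (f ` B) / \<rho> \<le> infdist x B"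
    unfolding infdist_notempty[OF False]
  proof (rule cINF_greatest[OF False])
    fix y assume "y \<in> B"
    then have "infdist (f x) (f ` B) \<le> \<rho> * dist x y"
      using infdist_le[of "f y" "f ` B" "f x"] by (simp add: d)
    then show "infdist (f x) (f ` B) / \<rho> \<le> dist x y"
      using \<rho> by (simp add: field_simps)
  qed
  ultimately show ?thesis using \<rho> by (simp add: field_simps)
qed (simp add: infdist_def)

section \<open>Inner parallel sets\<close>

lemma inner_parallel_set_similarity_image:
  fixes f :: "'a::euclidean_space \<Rightarrow> 'a"
  assumes "similarity f \<rho>"
  shows "inner_parallel_set (f ` A) \<delta> = f ` inner_parallel_set A (\<delta> / \<rho>)"
  using assms
  by (auto simp: inner_parallel_set_def similarity_image_Compl[OF assms]
      infdist_similarity_image[OF assms] pos_le_divide_eq similarity_def mult.commute)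

lemma inner_parallel_set_eq_Diff:
  "inner_parallel_set A \<delta> = A - (A \<inter> {x. \<delta> < infdist x (- A)})"
  by (auto simp: inner_parallel_set_def)

lemma open_infdist_greater: "open {x. \<delta> < infdist x (B::'a::metric_space set)}"
  by (intro open_Collect_less continuous_intros)

lemma inner_parallel_set_lmeasurable:
  fixes A :: "'a::euclidean_space set"
  assumes "open A" "bounded A"
  shows "inner_parallel_set A \<delta> \<in> lmeasurable"
  unfolding inner_parallel_set_eq_Diff using assms
  by (intro fmeasurable_Diff lmeasurable_open open_Int open_infdist_greater)
    (auto simp: bounded_subset open_Int open_infdist_greater)

text \<open>An inner parallel set of an open set is the difference of two open sets, hence the scaling of
  volumes of open sets is all that is needed.\<close>

lemma inner_volume_similarity_image:
  fixes f :: "'a::euclidean_space \<Rightarrow> 'a"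
  assumes f: "similarity f \<rho>" and A: "open A" "bounded A"
  shows "inner_volume (f ` A) \<delta> = \<rho> ^ DIM('a) * inner_volume A (\<delta> / \<rho>)"
proof -
  define B where "B = A \<inter> {x. \<delta> / \<rho> < infdist x (- A)}"
  have B: "open B" "bounded B" "B \<subseteq> A"
    using A unfolding B_def by (auto simp: bounded_subset open_Int open_infdist_greater)
  have bf: "bounded (f ` X)" if "bounded X" for X
  proof -
    obtain e where "X \<subseteq> ball 0 e" using bounded_subset_ballD[of X 0] \<open>bounded X\<close> by auto
    then have "f ` X \<subseteq> ball (f 0) (\<rho> * e)"
      using similarity_image_ball[OF f, of 0 e] by blast
    then show ?thesis by (rule bounded_subset[OF bounded_ball])
  qed
  have fo: "open (f ` A)" "open (f ` B)"
    using A B by (auto intro: similarity_image_open[OF f])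
  have "inner_volume (f ` A) \<delta> = measure lebesgue (f ` A - f ` B)"
    unfolding inner_volume_def inner_parallel_set_similarity_image[OF f]
    by (simp add: inner_parallel_set_eq_Diff B_def[symmetric] image_set_diff similarity_inj[OF f])
  also have "\<dots> = measure lebesgue (f ` A) - measure lebesgue (f ` B)"
  proof (rule measure_Diff)
    show "emeasure lebesgue (f ` A) \<noteq> \<infinity>"
      using emeasure_bounded_finite[OF bf[OF A(2)]] fo by (simp add: less_top)
  qed (use fo B(3) in auto)
  also have "\<dots> = \<rho> ^ DIM('a) * (measure lebesgue A - measure lebesgue B)"
    using A B by (simp add: measure_similarity_image_open[OF f] algebra_simps)
  also have "measure lebesgue A - measure lebesgue B = measure lebesgue (A - B)"
  proof (rule measure_Diff[symmetric])
    show "emeasure lebesgue A \<noteq> \<infinity>"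
      using emeasure_bounded_finite[OF A(2)] A(1) by (simp add: less_top)
  qed (use A B in auto)
  also have "A - B = inner_parallel_set A (\<delta> / \<rho>)"
    by (simp add: inner_parallel_set_eq_Diff B_def)
  finally show ?thesis by (simp add: inner_volume_def)
qed

text \<open>Enlarging an open set by a disjoint open set does not change the distance of its points to the
  complement: a nearest point \<open>y\<close> outside \<open>A\<close> cannot lie in \<open>B\<close>, since moving it a little towards \<open>x\<close>
  would stay in \<open>B\<close> and give a nearer point outside \<open>A\<close>.\<close>

lemma infdist_Compl_Un:
  fixes A B :: "'a::euclidean_space set"
  assumes "open A" "open B" "A \<inter> B = {}" "x \<in> A" "A \<union> B \<noteq> UNIV"
  shows "infdist x (- (A \<union> B)) = infdist x (- A)"
proof (rule antisym)
  have "closed (- A)" "- A \<noteq> {}" using assms by auto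
  then obtain y where y: "y \<in> - A" "infdist x (- A) = dist x y"
    using infdist_attains_inf by metis
  have "y \<notin> B"
  proof
    assume "y \<in> B"
    then obtain e where e: "e > 0" "ball y e \<subseteq> B" using \<open>open B\<close> open_contains_ball by blast
    have pos: "dist x y > 0" using y assms by auto
    define t where "t = min (1/2) (e / (2 * dist x y))"
    have t: "0 < t" "t < 1" "t * dist x y < e"
      using e pos by (auto simp: t_def min_def field_simps)
    define z where "z = y + t *\<^sub>R (x - y)"
    have "z - y = t *\<^sub>R (x - y)" "x - z = (1 - t) *\<^sub>R (x - y)"
      by (auto simp: z_def algebra_simps)
    then have "dist y z = t * dist x y" and xz: "dist x z = (1 - t) * dist x y"
      using t by (auto simp: dist_norm norm_minus_commute[of y z])
    then have "z \<in> B" using e t by auto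
    then have "infdist x (- A) \<le> dist x z" using assms(3) by (intro infdist_le) auto
    then show False using y(2) xz mult_pos_pos[OF t(1) pos] by (simp add: algebra_simps)
  qed
  then show "infdist x (- (A \<union> B)) \<le> infdist x (- A)"
    using y by (auto intro: infdist_le)
  show "infdist x (- A) \<le> infdist x (- (A \<union> B))"
    using assms by (intro infdist_mono) auto
qed

lemma inner_parallel_set_UN:
  fixes A :: "'i \<Rightarrow> 'a::euclidean_space set"
  assumes op: "\<And>i. i \<in> I \<Longrightarrow> open (A i)" and disj: "disjoint_family_on A I"
    and ne: "(\<Union>i\<in>I. A i) \<noteq> UNIV"
  shows "inner_parallel_set (\<Union>i\<in>I. A i) \<delta> = (\<Union>i\<in>I. inner_parallel_set (A i) \<delta>)"
proof -
  define S where "S = (\<Union>i\<in>I. A i)"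
  have mem: "x \<in> S \<longleftrightarrow> (\<exists>i\<in>I. x \<in> A i)" for x by (simp add: S_def)
  have eq: "infdist x (- S) = infdist x (- A j)" if "j \<in> I" "x \<in> A j" for x j
  proof -
    have U: "S = A j \<union> (\<Union>i\<in>I - {j}. A i)" using that by (auto simp: S_def)
    show ?thesis unfolding U
    proof (rule infdist_Compl_Un)
      show "A j \<inter> (\<Union>i\<in>I - {j}. A i) = {}"
        using disj that(1) by (fastforce simp: disjoint_family_on_def)
      show "A j \<union> (\<Union>i\<in>I - {j}. A i) \<noteq> UNIV" using ne U by (simp add: S_def)
    qed (use op that in auto)
  qed
  show ?thesis unfolding S_def[symmetric] by (auto simp: inner_parallel_set_def mem eq)
qed

lemma infdist_Compl_le_inradius:
  fixes A :: "'a::euclidean_space set"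
  assumes "open A" "bounded A" "x \<in> A"
  shows "infdist x (- A) \<le> inradius A"
proof -
  have "- A \<noteq> {}" using assms(2) not_bounded_UNIV by (metis Compl_UNIV_eq double_complement)
  then have pos: "0 < infdist x (- A)"
    using assms by (intro infdist_pos_not_in_closed) auto
  have sub: "ball x (infdist x (- A)) \<subseteq> A"
  proof
    fix y assume "y \<in> ball x (infdist x (- A))"
    then show "y \<in> A" using infdist_le[of y "- A" x] by auto
  qed
  obtain a M where M: "A \<subseteq> cball a M" using assms(2) bounded_subset_cball by blast
  have "bdd_above {\<rho>. 0 < \<rho> \<and> (\<exists>x. ball x \<rho> \<subseteq> A)}"
  proof (rule bdd_aboveI[of _ M])
    fix \<rho> assume "\<rho> \<in> {\<rho>. 0 < \<rho> \<and> (\<exists>x. ball x \<rho> \<subseteq> A)}"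
    then obtain y where "0 < \<rho>" "ball y \<rho> \<subseteq> cball a M" using M by blast
    then have "dist y a + \<rho> \<le> M" by (auto simp: ball_subset_cball_iff)
    then show "\<rho> \<le> M" using zero_le_dist[of y a] by linarith
  qed
  then show ?thesis unfolding inradius_def using pos sub by (intro cSup_upper) auto
qed

lemma inner_parallel_set_eq_self:
  fixes A :: "'a::euclidean_space set"
  assumes "open A" "bounded A" "inradius A \<le> \<delta>"
  shows "inner_parallel_set A \<delta> = A"
  using infdist_Compl_le_inradius[OF assms(1,2)] assms(3) by (force simp: inner_parallel_set_def)

section \<open>The volume of a self-similar tiling\<close>

lemma word_map_Nil [simp]: "word_map \<Phi> [] = id"
  by (simp add: word_map_def)

lemma word_map_Cons [simp]: "word_map \<Phi> (n # w) = \<Phi> n \<circ> word_map \<Phi> w"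
  by (simp add: word_map_def)

lemma similarity_word_map:
  assumes "similarity_system N \<Phi> r" "w \<in> lists {1..N}"
  shows "similarity (word_map \<Phi> w) (word_ratio r w)"
  using assms(2)
proof induction
  case (Cons n w)
  then have "contractive_similarity (\<Phi> n) (r n)"
    using assms(1) by (simp add: similarity_system_def)
  with Cons show ?case
    by (auto simp: similarity_def contractive_similarity_def word_ratio_def)
qed (simp add: similarity_def word_ratio_def)

lemma word_map_image_subset:
  assumes "feasible_open_set N \<Phi> U" "w \<in> lists {1..N}"
  shows "word_map \<Phi> w ` U \<subseteq> U"
  using assms(2)
proof induction
  case (Cons n w)
  then have "\<Phi> n ` U \<subseteq> U" using assms(1) by (simp add: feasible_open_set_def)
  then show ?case using Cons.IH by (auto simp: image_comp[symmetric])
qed simp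

text \<open>Images of \<open>G\<close> under different words: where the words first differ, either one of them has
  ended, and then \<open>G\<close> avoids the images \<open>\<Phi> n ` closure U\<close>, or their letters differ, and then the images
  of \<open>U\<close> are disjoint.\<close>

lemma disjoint_word_map_images:
  fixes \<Phi> :: "nat \<Rightarrow> 'a::euclidean_space \<Rightarrow> 'a"
  assumes sys: "similarity_system N \<Phi> r" and feas: "feasible_open_set N \<Phi> U"
    and G: "G \<subseteq> U - set_map N \<Phi> (closure U)"
    and "w \<in> lists {1..N}" "v \<in> lists {1..N}" "w \<noteq> v"
  shows "word_map \<Phi> w ` G \<inter> word_map \<Phi> v ` G = {}"
  using assms(4-)
proof (induction w arbitrary: v)
  case Nil
  then obtain n v' where v: "v = n # v'" "n \<in> {1..N}" "v' \<in> lists {1..N}" by (cases v) auto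
  have "word_map \<Phi> v' ` G \<subseteq> closure U"
    using word_map_image_subset[OF feas v(3)] G closure_subset[of U] by blast
  then have "\<Phi> n ` (word_map \<Phi> v' ` G) \<subseteq> set_map N \<Phi> (closure U)"
    unfolding set_map_def using v(2) by blast
  then have "word_map \<Phi> v ` G \<subseteq> set_map N \<Phi> (closure U)"
    by (simp add: v(1) image_comp)
  then show ?case using G by auto
next
  case (Cons n w)
  then have n: "n \<in> {1..N}" by simp
  have wU: "word_map \<Phi> w ` G \<subseteq> U"
    using word_map_image_subset[OF feas Cons.hyps(2)] G by blast
  show ?case
  proof (cases v)
    case Nil
    have "\<Phi> n ` (word_map \<Phi> w ` G) \<subseteq> set_map N \<Phi> (closure U)"
      unfolding set_map_def using wU n closure_subset[of U] by blast
    then have "word_map \<Phi> (n # w) ` G \<subseteq> set_map N \<Phi> (closure U)"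
      by (simp add: image_comp)
    then show ?thesis using G Nil by auto
  next
    case (Cons m v')
    then have m: "m \<in> {1..N}" "v' \<in> lists {1..N}" using Cons.prems by auto
    have vU: "word_map \<Phi> v' ` G \<subseteq> U"
      using word_map_image_subset[OF feas m(2)] G by blast
    show ?thesis
    proof (cases "m = n")
      case True
      then have "word_map \<Phi> w ` G \<inter> word_map \<Phi> v' ` G = {}"
        using Cons.IH m Cons.prems \<open>v = m # v'\<close> by auto
      moreover have "inj (\<Phi> n)"
        using similarity_word_map[OF sys, of "[n]"] n similarity_inj by fastforce
      ultimately show ?thesis
        using True \<open>v = m # v'\<close> by (auto simp: inj_def)
    next
      case False
      then have "\<Phi> n ` U \<inter> \<Phi> m ` U = {}"
        using feas n m by (auto simp: feasible_open_set_def)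
      then show ?thesis using wU vU \<open>v = m # v'\<close> by fastforce
    qed
  qed
qed

lemma generator_properties:
  fixes \<Phi> :: "nat \<Rightarrow> 'a::euclidean_space \<Rightarrow> 'a"
  assumes sys: "similarity_system N \<Phi> r" and feas: "feasible_open_set N \<Phi> U"
    and gen: "generators N \<Phi> U = {G}"
  shows "G = U - set_map N \<Phi> (closure U)" "open G" "bounded G" "G \<noteq> {}"
proof -
  show eq: "G = U - set_map N \<Phi> (closure U)"
    using gen Union_components[of "U - set_map N \<Phi> (closure U)"] by (simp add: generators_def)
  have U: "open U" "bounded U" using feas by (auto simp: feasible_open_set_def)
  have "compact (\<Phi> n ` closure U)" if "n \<in> {1..N}" for n
  proof (rule compact_continuous_image)
    have d: "dist (\<Phi> n x) (\<Phi> n y) = r n * dist x y" and r: "r n > 0" for x y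
      using sys that by (auto simp: similarity_system_def contractive_similarity_def)
    show "continuous_on (closure U) (\<Phi> n)"
      unfolding continuous_on_iff
    proof (intro ballI allI impI)
      fix x e :: real and a :: 'a assume "e > 0"
      then show "\<exists>\<delta>>0. \<forall>x'\<in>closure U. dist x' a < \<delta> \<longrightarrow> dist (\<Phi> n x') (\<Phi> n a) < e"
        using r by (intro exI[of _ "e / r n"]) (auto simp: d field_simps)
    qed
    show "compact (closure U)" using U by (simp add: compact_closure)
  qed
  then have "closed (set_map N \<Phi> (closure U))"
    unfolding set_map_def by (intro closed_UN) (auto intro: compact_imp_closed)
  then show "open G" using U by (simp add: eq open_Diff)
  show "bounded G" using U by (simp add: eq bounded_diff)
  show "G \<noteq> {}" using gen in_components_nonempty[of G] by (auto simp: generators_def)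
qed

text \<open>The inner parallel volume of the tiling as a sum over words.  Since the tiles are disjoint subsets
  of the bounded set \<open>U\<close>, their total volume is finite, which yields the convergence of the string's
  Dirichlet series at the dimension of the space.\<close>

proposition tiling_volume_sums:
  fixes \<Phi> :: "nat \<Rightarrow> 'a::euclidean_space \<Rightarrow> 'a"
  assumes sys: "similarity_system N \<Phi> r" and feas: "feasible_open_set N \<Phi> U"
    and gen: "generators N \<Phi> U = {G}"
    and ord: "word_ordering N r W" and l: "l = word_string r W"
  shows "(\<lambda>i. l (Suc i) ^ DIM('a) * inner_volume G (\<delta> / l (Suc i)))
           sums tiling_inner_volume (self_similar_tiling N \<Phi> U) \<delta>"
    and "summable (\<lambda>i. l (Suc i) ^ DIM('a))"
proof -
  note G = generator_properties[OF sys feas gen]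
  have bij: "bij_betw W {1..} (lists {1..N})" using ord by (simp add: word_ordering_def)
  have W: "W (Suc i) \<in> lists {1..N}" for i using bij_betwE[OF bij] by simp
  define tile where "tile i = word_map \<Phi> (W (Suc i)) ` G" for i
  have sim: "similarity (word_map \<Phi> (W (Suc i))) (l (Suc i))" for i
    using similarity_word_map[OF sys W] by (simp add: l word_string_def)
  have lpos: "l (Suc i) > 0" for i using sim by (auto simp: similarity_def)
  have tU: "tile i \<subseteq> U" for i
    using word_map_image_subset[OF feas W, of i] G(1) by (auto simp: tile_def)
  have U: "open U" "bounded U" using feas by (auto simp: feasible_open_set_def)
  have to: "open (tile i)" "bounded (tile i)" for i
    using similarity_image_open[OF sim G(2)] bounded_subset[OF U(2) tU] by (auto simp: tile_def)
  have disj: "disjoint_family tile"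
    unfolding disjoint_family_on_def
  proof (intro ballI impI)
    fix i j :: nat assume "i \<noteq> j"
    then have "W (Suc i) \<noteq> W (Suc j)"
      using bij unfolding bij_betw_def inj_on_def by auto
    then show "tile i \<inter> tile j = {}"
      unfolding tile_def using disjoint_word_map_images[OF sys feas _ W W] G(1) by blast
  qed
  have Un: "\<Union> (self_similar_tiling N \<Phi> U) = (\<Union>i. tile i)"
  proof -
    have "lists {1..N} = W ` {1..}" using bij by (simp add: bij_betw_def)
    also have "{1..} = range Suc"
    proof (rule set_eqI)
      show "n \<in> {1..} \<longleftrightarrow> n \<in> range Suc" for n by (cases n) auto
    qed
    finally have "lists {1..N} = range (\<lambda>i. W (Suc i))" by (simp add: image_comp o_def)
    then show ?thesis
      unfolding self_similar_tiling_def gen tile_def by auto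
  qed
  have UnU: "(\<Union>i. tile i) \<subseteq> U" using tU by blast
  have ne: "(\<Union>i. tile i) \<noteq> UNIV" using UnU U(2) bounded_subset not_bounded_UNIV by metis
  have fin: "emeasure lebesgue X \<noteq> \<infinity>" if "X \<subseteq> U" for X
  proof -
    have "emeasure lebesgue X \<le> emeasure lebesgue U" using that U(1) by (intro emeasure_mono) auto
    also have "\<dots> < \<infinity>" using emeasure_bounded_finite[OF U(2)] U(1) by simp
    finally show ?thesis by simp
  qed
  have "(\<lambda>i. measure lebesgue (inner_parallel_set (tile i) \<delta>))
      sums measure lebesgue (\<Union>i. inner_parallel_set (tile i) \<delta>)"
  proof (rule measure_UNION)
    show "range (\<lambda>i. inner_parallel_set (tile i) \<delta>) \<subseteq> sets lebesgue"
      using inner_parallel_set_lmeasurable[OF to] by (auto simp: fmeasurable_def)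
    show "disjoint_family (\<lambda>i. inner_parallel_set (tile i) \<delta>)"
      using disj by (rule disjoint_family_on_bisimulation) (auto simp: inner_parallel_set_def)
    show "emeasure lebesgue (\<Union>i. inner_parallel_set (tile i) \<delta>) \<noteq> \<infinity>"
      using UnU by (intro fin) (auto simp: inner_parallel_set_def)
  qed
  also have "(\<Union>i. inner_parallel_set (tile i) \<delta>) = inner_parallel_set (\<Union>i. tile i) \<delta>"
    using to(1) disj ne by (intro inner_parallel_set_UN[symmetric]) auto
  finally show "(\<lambda>i. l (Suc i) ^ DIM('a) * inner_volume G (\<delta> / l (Suc i)))
      sums tiling_inner_volume (self_similar_tiling N \<Phi> U) \<delta>"
    unfolding tiling_inner_volume_def Un inner_volume_def[symmetric]
    by (simp add: tile_def inner_volume_similarity_image[OF sim G(2,3)])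
  have "(\<lambda>i. measure lebesgue (tile i)) sums measure lebesgue (\<Union>i. tile i)"
    using to disj UnU by (intro measure_UNION fin) auto
  then have "summable (\<lambda>i. l (Suc i) ^ DIM('a) * measure lebesgue G)"
    by (simp add: tile_def measure_similarity_image_open[OF sim G(2)] sums_iff)
  moreover have "measure lebesgue G > 0"
  proof -
    obtain x e where e: "e > 0" "ball x e \<subseteq> G" using G(2,4) open_contains_ball by blast
    have "0 < measure lebesgue (ball x e)" using e(1) by (simp add: content_ball_pos)
    also have "\<dots> \<le> measure lebesgue G"
      using e G(2,3) by (intro measure_mono_fmeasurable) (auto intro: lmeasurable_open)
    finally show ?thesis .
  qed
  ultimately show "summable (\<lambda>i. l (Suc i) ^ DIM('a))"
    using summable_mult2[of "\<lambda>i. l (Suc i) ^ DIM('a) * measure lebesgue G" "inverse (measure lebesgue G)"]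
    by (simp add: mult.assoc)
qed

section \<open>The zeta function of the string\<close>

lemma of_real_powr_eq_exp:
  "0 < x \<Longrightarrow> complex_of_real x powr s = exp (s * of_real (ln x))"
  by (simp add: powr_def Ln_of_real)

lemma of_real_powr_of_nat: "0 < x \<Longrightarrow> complex_of_real x powr of_nat n = of_real x ^ n"
  by (simp add: of_real_powr_eq_exp exp_of_nat_mult exp_of_real)

lemma norm_of_real_powr: "0 < x \<Longrightarrow> norm (complex_of_real x powr s) = x powr Re s"
  by (simp add: of_real_powr_eq_exp powr_def)

text \<open>Identity theorem for nicely meromorphic functions: their difference vanishes on
  a half plane, hence, once its singularities are removed, everywhere, and the normalization of the values (\<open>0\<close> at poles,
  the limit elsewhere) turns equality near every point into equality.\<close>

lemma nicely_meromorphic_eq_of_half_plane: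
  assumes f: "f nicely_meromorphic_on UNIV" and g: "g nicely_meromorphic_on UNIV"
    and eq: "\<And>s. \<sigma> < Re s \<Longrightarrow> f s = g s"
  shows "f = g"
proof -
  define h where "h = remove_sings (\<lambda>s. f s - g s)"
  have mero: "(\<lambda>s. f s - g s) meromorphic_on UNIV"
    using f g by (intro meromorphic_intros) (auto simp: nicely_meromorphic_on_def)
  have hm: "h nicely_meromorphic_on UNIV"
    unfolding h_def using mero by (rule remove_sings_nicely_meromorphic)
  have opn: "open {s. \<sigma> < Re s}" by (simp add: open_halfspace_Re_gt)
  have h0: "h s = 0" if "\<sigma> < Re s" for s
  proof -
    have "\<forall>\<^sub>F w in at s. w \<in> {s. \<sigma> < Re s} - {s}"
      using opn that by (intro eventually_at_in_open) auto
    then have "\<forall>\<^sub>F w in at s. f w - g w = 0"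
      by eventually_elim (use eq in auto)
    then have "(\<lambda>w. f w - g w) \<midarrow>s\<rightarrow> 0" by (simp add: tendsto_eventually)
    then show ?thesis unfolding h_def by (rule remove_sings_eqI)
  qed
  have hz: "h s = 0" for s
  proof (rule ccontr)
    assume "h s \<noteq> 0"
    then have "\<forall>\<^sub>\<approx>x\<in>UNIV. h x \<noteq> 0"
      using nicely_meromorphic_imp_constant_or_avoid[OF hm, of 0] by auto
    then have "\<forall>\<^sub>F x in at (of_real (\<sigma> + 1)). h x \<noteq> 0"
      by (simp add: eventually_cosparse_open_eq)
    moreover have "\<forall>\<^sub>F x in at (of_real (\<sigma> + 1)). x \<in> {s. \<sigma> < Re s}"
      using opn by (intro eventually_at_in_open') auto
    ultimately have "\<forall>\<^sub>F x in at (complex_of_real (\<sigma> + 1)). False"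
      by eventually_elim (use h0 in auto)
    then show False by simp
  qed
  have ev: "\<forall>\<^sub>F w in at s. f w = g w" for s
  proof -
    have "isolated_singularity_at (\<lambda>s. f s - g s) s"
      using meromorphic_on_subset[OF mero, of "{s}"] by (auto simp: meromorphic_at_iff)
    then have "\<forall>\<^sub>F w in at s. h w = f w - g w"
      unfolding h_def by (rule eventually_remove_sings_eq_at)
    then show ?thesis by eventually_elim (use hz in simp)
  qed
  show "f = g"
  proof
    fix s
    have pole: "is_pole f s \<longleftrightarrow> is_pole g s" using ev by (intro is_pole_cong) auto
    have lim: "(f \<longlongrightarrow> c) (at s) \<longleftrightarrow> (g \<longlongrightarrow> c) (at s)" for c using ev by (intro tendsto_cong)
    have fs: "is_pole f s \<and> f s = 0 \<or> f \<midarrow>s\<rightarrow> f s" and gs: "is_pole g s \<and> g s = 0 \<or> g \<midarrow>s\<rightarrow> g s"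
      using f g by (auto simp: nicely_meromorphic_on_def)
    show "f s = g s"
    proof (cases "is_pole f s")
      case True
      then have "\<not> f \<midarrow>s\<rightarrow> f s" "\<not> g \<midarrow>s\<rightarrow> g s"
        using pole not_tendsto_and_filterlim_at_infinity[of "at s"] by (auto simp: is_pole_def)
      then show ?thesis using fs gs by simp
    next
      case False
      then have "f \<midarrow>s\<rightarrow> f s" "g \<midarrow>s\<rightarrow> g s" using fs gs pole by auto
      then show ?thesis using lim tendsto_unique[OF _ _ ] by (meson LIM_unique)
    qed
  qed
qed

text \<open>The exponential sum \<open>\<Sum>n=1..N. r n powr s\<close>; the complex dimensions are the solutions of
  \<open>ratio_sum N r s = 1\<close>.\<close>

definition ratio_sum :: "nat \<Rightarrow> (nat \<Rightarrow> real) \<Rightarrow> complex \<Rightarrow> complex" where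
  "ratio_sum N r s = (\<Sum>n=1..N. of_real (r n) powr s)"

lemma word_ratio_pos:
  assumes "\<And>n. n \<in> {1..N} \<Longrightarrow> 0 < r n" "w \<in> lists {1..N}"
  shows "0 < word_ratio r w"
  using assms(2) by induction (use assms(1) in \<open>auto simp: word_ratio_def\<close>)

lemma lists_eq_insert_Nil: "lists A = insert [] (\<Union>a\<in>A. (#) a ` lists A)"
proof -
  have "w \<in> insert [] (\<Union>a\<in>A. (#) a ` lists A)" if "w \<in> lists A" for w
    using that by cases auto
  then have "lists A \<subseteq> insert [] (\<Union>a\<in>A. (#) a ` lists A)" by blast
  moreover have "insert [] (\<Union>a\<in>A. (#) a ` lists A) \<subseteq> lists A" by auto
  ultimately show ?thesis by (rule equalityI)
qed

text \<open>Splitting off the first letter of the nonempty words gives the renewal equation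
  \<open>Z = 1 + ratio_sum N r s * Z\<close> for the sum over all words.\<close>

lemma word_ratio_renewal:
  assumes pos: "\<And>n. n \<in> {1..N} \<Longrightarrow> 0 < r n"
    and Z: "((\<lambda>w. complex_of_real (word_ratio r w) powr s) has_sum Z) (lists {1..N})"
  shows "Z * (1 - ratio_sum N r s) = 1"
proof -
  let ?f = "\<lambda>w. complex_of_real (word_ratio r w) powr s"
  have cons: "?f (n # w) = of_real (r n) powr s * ?f w" if "n \<in> {1..N}" "w \<in> lists {1..N}" for n w
    using pos[OF that(1)] word_ratio_pos[OF pos that(2)]
    by (simp add: word_ratio_def powr_times_real less_imp_le)
  have "(?f has_sum (of_real (r n) powr s * Z)) ((#) n ` lists {1..N})" if "n \<in> {1..N}" for n
  proof -
    have "((\<lambda>w. of_real (r n) powr s * ?f w) has_sum (of_real (r n) powr s * Z)) (lists {1..N})"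
      using Z by (rule has_sum_cmult_right)
    then have "((\<lambda>w. ?f (n # w)) has_sum (of_real (r n) powr s * Z)) (lists {1..N})"
      by (rule has_sum_cong[THEN iffD1, rotated]) (simp add: cons[OF that])
    then show ?thesis
      by (subst has_sum_reindex) (auto simp: o_def)
  qed
  then have "(?f has_sum (\<Sum>n\<in>{1..N}. of_real (r n) powr s * Z)) (\<Union>n\<in>{1..N}. (#) n ` lists {1..N})"
    by (intro sum_has_sum) auto
  then have "(?f has_sum (?f [] + (\<Sum>n\<in>{1..N}. of_real (r n) powr s * Z)))
      (insert [] (\<Union>n\<in>{1..N}. (#) n ` lists {1..N}))"
    by (intro has_sum_insert) auto
  then have "(?f has_sum (1 + ratio_sum N r s * Z)) (lists {1..N})"
    by (subst lists_eq_insert_Nil) (simp add: word_ratio_def ratio_sum_def sum_distrib_right)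
  then have "Z = 1 + ratio_sum N r s * Z" using Z has_sum_unique by blast
  then show ?thesis by (simp add: algebra_simps)
qed

lemma ratio_sum_holomorphic:
  assumes pos: "\<And>n. n \<in> {1..N} \<Longrightarrow> 0 < r n"
  shows "ratio_sum N r holomorphic_on A"
proof -
  have "(\<lambda>s. of_real (r n) powr s) holomorphic_on A" if "n \<in> {1..N}" for n
    using pos[OF that] by (simp add: powr_def) (intro holomorphic_intros)
  then show ?thesis unfolding ratio_sum_def[abs_def] by (intro holomorphic_on_sum) auto
qed

lemma powr_at_bot_0:
  fixes a :: real
  assumes "1 < a"
  shows "((\<lambda>t. a powr t) \<longlongrightarrow> 0) at_bot"
proof -
  have "filterlim (\<lambda>t. ln a * t) at_bot at_bot"
    using assms by (intro filterlim_tendsto_pos_mult_at_bot[OF tendsto_const]) (auto simp: filterlim_ident)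
  then have "((\<lambda>t. exp (ln a * t)) \<longlongrightarrow> 0) at_bot"
    by (rule filterlim_compose[OF exp_at_bot])
  then show ?thesis using assms by (simp add: powr_def mult.commute)
qed

text \<open>Far to the left the powers of the smallest ratio \<open>\<rho>\<close> dominate: these powers are equal, so they do
  not cancel each other, and the remaining terms, including the constant \<open>1\<close>, are negligible against \<open>\<rho> powr Re s\<close>.\<close>

lemma ratio_sum_left_bound:
  assumes N: "1 \<le> N" and r: "\<forall>n\<in>{1..N}. 0 < r n \<and> r n < 1"
  shows "\<exists>M. \<forall>s. Re s \<le> - M \<longrightarrow> 1 / 2 \<le> norm (1 - ratio_sum N r s)"
proof -
  define \<rho> where "\<rho> = Min (r ` {1..N})"
  define I where "I = {n \<in> {1..N}. r n = \<rho>}"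
  have \<rho>_mem: "\<rho> \<in> r ` {1..N}" unfolding \<rho>_def using N by (intro Min_in) auto
  then have \<rho>: "0 < \<rho>" "\<rho> < 1" and "I \<noteq> {}" using r by (auto simp: I_def)
  have \<rho>_less: "\<rho> < r n" if "n \<in> {1..N} - I" for n
  proof -
    have "\<rho> \<le> r n" unfolding \<rho>_def using that by (intro Min_le) auto
    then show ?thesis using that by (auto simp: I_def)
  qed
  define \<phi> where "\<phi> t = (1 / \<rho>) powr t + (\<Sum>n\<in>{1..N} - I. (r n / \<rho>) powr t)" for t
  have "(\<phi> \<longlongrightarrow> 0 + (\<Sum>n\<in>{1..N} - I. 0)) at_bot"
    unfolding \<phi>_def[abs_def] using \<rho> \<rho>_less
    by (intro tendsto_add tendsto_sum powr_at_bot_0) (auto simp: less_divide_eq)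
  then have "\<forall>\<^sub>F t in at_bot. \<phi> t < 1 / 2" by (intro order_tendstoD(2)) auto
  then obtain M where M: "\<And>t. t \<le> M \<Longrightarrow> \<phi> t < 1 / 2"
    by (auto simp: eventually_at_bot_linorder)
  show ?thesis
  proof (intro exI[of _ "\<bar>M\<bar>"] allI impI)
    fix s assume s: "Re s \<le> - \<bar>M\<bar>"
    define t where "t = Re s"
    have npow: "norm (complex_of_real a powr s) = a powr t" if "a > 0" for a
      using that by (simp add: norm_of_real_powr t_def)
    have split: "ratio_sum N r s = of_nat (card I) * of_real \<rho> powr s
        + (\<Sum>n\<in>{1..N} - I. of_real (r n) powr s)"
    proof -
      have "ratio_sum N r s = (\<Sum>n\<in>I. of_real (r n) powr s) + (\<Sum>n\<in>{1..N} - I. of_real (r n) powr s)"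
        unfolding ratio_sum_def by (subst sum.subset_diff[of I]) (auto simp: I_def)
      also have "(\<Sum>n\<in>I. complex_of_real (r n) powr s) = (\<Sum>n\<in>I. of_real \<rho> powr s)"
        by (intro sum.cong) (auto simp: I_def)
      finally show ?thesis by simp
    qed
    have "card I \<ge> 1" using \<open>I \<noteq> {}\<close> by (simp add: I_def Suc_le_eq card_gt_0_iff)
    then have c: "\<rho> powr t \<le> norm (of_nat (card I) * complex_of_real \<rho> powr s)"
      using \<rho> by (simp add: norm_mult npow)
    have "norm (\<Sum>n\<in>{1..N} - I. complex_of_real (r n) powr s) \<le> (\<Sum>n\<in>{1..N} - I. r n powr t)"
      using r by (intro sum_norm_le) (auto simp: npow)
    also have "1 + \<dots> = \<rho> powr t * \<phi> t"
      using \<rho> r by (simp add: \<phi>_def powr_divide distrib_left sum_distrib_left)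
    finally have "1 + norm (\<Sum>n\<in>{1..N} - I. complex_of_real (r n) powr s) \<le> \<rho> powr t * \<phi> t"
      by simp
    also have "\<dots> \<le> \<rho> powr t * (1 / 2)"
    proof (rule mult_left_mono)
      have "t \<le> M" using s unfolding t_def by linarith
      then show "\<phi> t \<le> 1 / 2" using M less_imp_le by blast
    qed simp
    finally have d: "1 + norm (\<Sum>n\<in>{1..N} - I. complex_of_real (r n) powr s) \<le> \<rho> powr t / 2" by simp
    have "1 \<le> \<rho> powr t"
      using powr_mono'[of t 0 \<rho>] \<rho> s by (simp add: t_def)
    have "norm (of_nat (card I) * complex_of_real \<rho> powr s)
        \<le> norm (1 - ratio_sum N r s) + (1 + norm (\<Sum>n\<in>{1..N} - I. complex_of_real (r n) powr s))"
    proof -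
      let ?B = "\<Sum>n\<in>{1..N} - I. complex_of_real (r n) powr s"
      have "of_nat (card I) * complex_of_real \<rho> powr s = (1 - ?B) - (1 - ratio_sum N r s)"
        by (simp add: split)
      then have "norm (of_nat (card I) * complex_of_real \<rho> powr s)
          \<le> norm (1 - ?B) + norm (1 - ratio_sum N r s)"
        by (simp only: norm_triangle_ineq4)
      also have "norm (1 - ?B) \<le> 1 + norm ?B"
        using norm_triangle_ineq4[of 1 ?B] by simp
      finally show ?thesis by simp
    qed
    with c d \<open>1 \<le> \<rho> powr t\<close> show "1 / 2 \<le> norm (1 - ratio_sum N r s)" by linarith
  qed
qed

text \<open>In the following the string of a system of ratios is enumerated by \<open>W\<close>, and its Dirichlet series
  is assumed to converge at the natural number \<open>d\<close>, later the dimension of the space.\<close>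

context
  fixes N d :: nat and r :: "nat \<Rightarrow> real" and W :: "nat \<Rightarrow> nat list" and l :: "nat \<Rightarrow> real"
  assumes r: "\<forall>n\<in>{1..N}. 0 < r n \<and> r n < 1"
    and ord: "word_ordering N r W" and l: "l = word_string r W"
    and summ: "summable (\<lambda>i. l (Suc i) ^ d)"
begin

lemma word_string_bounds: "0 < l (Suc i)" "l (Suc i) \<le> 1"
proof -
  have W: "W (Suc i) \<in> lists {1..N}"
    using ord bij_betwE[of W "{1..}" "lists {1..N}"] by (simp add: word_ordering_def)
  show "0 < l (Suc i)" using word_ratio_pos[OF _ W, of r] r by (simp add: l word_string_def)
  have "word_ratio r w \<le> 1" if "w \<in> lists {1..N}" for w
    using that
  proof induction
    case (Cons n w)
    then have "0 < word_ratio r w" using word_ratio_pos[of N r w] r by simp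
    moreover have "r n < 1" "0 < r n" using r Cons.hyps by auto
    ultimately show ?case using Cons.IH
      by (simp add: word_ratio_def) (meson less_imp_le mult_le_one)
  qed (simp add: word_ratio_def)
  then show "l (Suc i) \<le> 1" using W by (simp add: l word_string_def)
qed

lemma norm_word_string_powr_le:
  assumes "real d \<le> Re s"
  shows "norm (complex_of_real (l (Suc i)) powr s) \<le> l (Suc i) ^ d"
proof -
  have "norm (complex_of_real (l (Suc i)) powr s) = l (Suc i) powr Re s"
    using word_string_bounds by (simp add: norm_of_real_powr)
  also have "\<dots> \<le> l (Suc i) powr real d"
    using word_string_bounds assms by (intro powr_mono') (auto simp: less_imp_le)
  finally show ?thesis using word_string_bounds by (simp add: powr_realpow)
qed

text \<open>By the renewal equation, convergence at \<open>d\<close> alone already forces \<open>ratio_sum N r s \<noteq> 1\<close> for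
  \<open>Re s \<ge> d\<close>; in particular no complex dimension lies there.\<close>

lemma zeta_series:
  assumes "real d \<le> Re s"
  shows "1 - ratio_sum N r s \<noteq> 0"
    and "((\<lambda>j. complex_of_real (l j) powr s) has_sum inverse (1 - ratio_sum N r s)) {1..}"
    and "(\<lambda>i. complex_of_real (l (Suc i)) powr s) sums inverse (1 - ratio_sum N r s)"
proof -
  have bij: "bij_betw W {1..} (lists {1..N})" using ord by (simp add: word_ordering_def)
  have bijS: "bij_betw Suc UNIV {1..}"
  proof -
    have "n \<in> {1..} \<longleftrightarrow> n \<in> range Suc" for n by (cases n) auto
    then have "range Suc = {1..}" by blast
    then show ?thesis by (simp add: bij_betw_def)
  qed
  have "summable (\<lambda>i. norm (complex_of_real (l (Suc i)) powr s))"
    by (rule summable_comparison_test'[OF summ, of 0]) (simp add: norm_word_string_powr_le[OF assms])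
  then have "(\<lambda>i. complex_of_real (l (Suc i)) powr s) summable_on UNIV"
    by (rule norm_summable_imp_summable_on)
  then obtain Z where Z: "((\<lambda>i. complex_of_real (l (Suc i)) powr s) has_sum Z) UNIV"
    by (auto simp: summable_on_def)
  then have Z1: "((\<lambda>j. complex_of_real (l j) powr s) has_sum Z) {1..}"
    using has_sum_reindex_bij_betw[OF bijS, of "\<lambda>j. complex_of_real (l j) powr s"] by simp
  then have "((\<lambda>w. complex_of_real (word_ratio r w) powr s) has_sum Z) (lists {1..N})"
    using has_sum_reindex_bij_betw[OF bij, of "\<lambda>w. complex_of_real (word_ratio r w) powr s"]
    by (simp add: l word_string_def)
  then have ZR: "Z * (1 - ratio_sum N r s) = 1" using word_ratio_renewal r by blast
  then show nz: "1 - ratio_sum N r s \<noteq> 0" by auto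
  have "Z = inverse (1 - ratio_sum N r s)" using ZR nz by (simp add: field_simps)
  then show "((\<lambda>j. complex_of_real (l j) powr s) has_sum inverse (1 - ratio_sum N r s)) {1..}"
    "(\<lambda>i. complex_of_real (l (Suc i)) powr s) sums inverse (1 - ratio_sum N r s)"
    using Z Z1 has_sum_imp_sums by auto
qed

lemma nicely_meromorphic_zeta:
  "(\<lambda>s. inverse (1 - ratio_sum N r s)) nicely_meromorphic_on UNIV"
proof -
  have "(\<lambda>s. 1 - ratio_sum N r s) holomorphic_on UNIV"
    using r by (intro holomorphic_on_diff holomorphic_on_const ratio_sum_holomorphic) auto
  then show ?thesis
    by (intro nicely_meromorphic_on_inverse analytic_on_imp_nicely_meromorphic_on)
      (simp add: analytic_on_open)
qed

lemma string_zeta_eq: "string_zeta l = (\<lambda>s. inverse (1 - ratio_sum N r s))"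
  unfolding string_zeta_def
proof (rule the_equality)
  show "(\<lambda>s. inverse (1 - ratio_sum N r s)) nicely_meromorphic_on UNIV \<and>
    (\<exists>\<sigma>. \<forall>s. \<sigma> < Re s \<longrightarrow>
      ((\<lambda>j. complex_of_real (l j) powr s) has_sum inverse (1 - ratio_sum N r s)) {1..})"
    using nicely_meromorphic_zeta zeta_series(2) by (auto intro!: exI[of _ "real d"])
next
  fix \<zeta> assume \<zeta>: "\<zeta> nicely_meromorphic_on UNIV \<and>
    (\<exists>\<sigma>. \<forall>s. \<sigma> < Re s \<longrightarrow> ((\<lambda>j. complex_of_real (l j) powr s) has_sum \<zeta> s) {1..})"
  then obtain \<sigma> where \<sigma>: "\<And>s. \<sigma> < Re s \<Longrightarrow> ((\<lambda>j. complex_of_real (l j) powr s) has_sum \<zeta> s) {1..}"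
    by auto
  show "\<zeta> = (\<lambda>s. inverse (1 - ratio_sum N r s))"
  proof (rule nicely_meromorphic_eq_of_half_plane)
    fix s assume "max \<sigma> (real d) < Re s"
    then show "\<zeta> s = inverse (1 - ratio_sum N r s)"
      using \<sigma>[of s] zeta_series(2)[of s] has_sum_unique by auto
  qed (use \<zeta> nicely_meromorphic_zeta in auto)
qed

lemma complex_dims_eq: "complex_dims l = {s. ratio_sum N r s = 1}"
proof -
  have ana: "(\<lambda>s. 1 - ratio_sum N r s) analytic_on UNIV"
    using r by (auto simp: analytic_on_open intro!: holomorphic_on_diff ratio_sum_holomorphic)
  have nconst: "\<forall>\<^sub>\<approx>s\<in>UNIV. 1 - ratio_sum N r s \<noteq> 0"
    using nicely_meromorphic_imp_constant_or_avoid[OF analytic_on_imp_nicely_meromorphic_on[OF ana], of 0]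
      zeta_series(1)[of "of_nat d"] by auto
  have "is_pole (\<lambda>s. inverse (1 - ratio_sum N r s)) \<omega> \<longleftrightarrow> 1 - ratio_sum N r \<omega> = 0" for \<omega>
  proof -
    have "isCont (\<lambda>s. 1 - ratio_sum N r s) \<omega>"
      using ana analytic_at_imp_isCont analytic_on_subset by blast
    then have lim: "((\<lambda>s. 1 - ratio_sum N r s) \<longlongrightarrow> 1 - ratio_sum N r \<omega>) (at \<omega>)"
      by (simp only: isCont_def)
    have "\<forall>\<^sub>F s in at \<omega>. 1 - ratio_sum N r s \<noteq> 0"
      using nconst by (simp add: eventually_cosparse_open_eq)
    then show ?thesis
      unfolding is_pole_inverse_iff isolated_zero_def
      using lim LIM_unique by metis
  qed
  then show ?thesis unfolding complex_dims_def string_zeta_eq by auto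
qed

lemma finite_complex_dims_bounded: "finite (complex_dims l \<inter> ball 0 R)"
proof -
  have "finite {z \<in> cball 0 R. 1 - ratio_sum N r z = 0}"
  proof (cases "\<exists>z. 1 - ratio_sum N r z = 0")
    case True
    then have "\<not> (\<lambda>s. 1 - ratio_sum N r s) constant_on UNIV"
      using zeta_series(1)[of "of_nat d"] unfolding constant_on_def by fastforce
    then show ?thesis
      using r by (intro holomorphic_compact_finite_zeros[of _ UNIV] holomorphic_on_diff
          holomorphic_on_const ratio_sum_holomorphic) auto
  qed simp
  then show ?thesis by (rule finite_subset[rotated]) (auto simp: complex_dims_eq)
qed

end

section \<open>Residues\<close>

lemma tendsto_residue_simple_pole:
  assumes "f meromorphic_on {z}" "is_pole f z" "zorder f z = - 1"
  shows "((\<lambda>w. f w * (w - z)) \<longlongrightarrow> residue f z) (at z)"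
proof -
  have iso: "isolated_singularity_at f z"
    using assms(1) by (auto simp: meromorphic_at_iff)
  then obtain e where e: "e > 0" "f analytic_on ball z e - {z}"
    by (auto simp: isolated_singularity_at_def)
  have holo: "f holomorphic_on ball z e - {z}" using e(2) analytic_imp_holomorphic by blast
  obtain \<delta> where \<delta>: "\<delta> > 0" "zor_poly f z holomorphic_on cball z \<delta>"
      "\<forall>w\<in>cball z \<delta> - {z}. f w = zor_poly f z w / (w - z)"
    using zorder_exist_pole[OF holo open_ball _ assms(2)] e(1) assms(3) by auto
  have "isCont (zor_poly f z) z"
    using \<delta>(1,2) by (intro continuous_on_interior[of "cball z \<delta>"] holomorphic_on_imp_continuous_on) auto
  then have "(zor_poly f z \<longlongrightarrow> zor_poly f z z) (at z)" by (simp add: isCont_def)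
  moreover have "\<forall>\<^sub>F w in at z. zor_poly f z w = f w * (w - z)"
  proof -
    have "\<forall>\<^sub>F w in at z. w \<in> ball z \<delta> - {z}" using \<delta>(1) by (intro eventually_at_in_open) auto
    then show ?thesis by eventually_elim (use \<delta>(3) in auto)
  qed
  ultimately have "((\<lambda>w. f w * (w - z)) \<longlongrightarrow> zor_poly f z z) (at z)"
    by (rule Lim_transform_eventually)
  then show ?thesis using residue_simple_pole[OF iso assms(2,3)] by simp
qed

lemma residue_eq_limit:
  assumes "h meromorphic_on {z}" "((\<lambda>w. h w * (w - z)) \<longlongrightarrow> c) (at z)"
  shows "residue h z = c"
proof -
  obtain e where e: "e > 0" "h analytic_on ball z e - {z}"
    using assms(1) by (auto simp: meromorphic_at_iff isolated_singularity_at_def)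
  then show ?thesis
    using assms(2) by (intro residue_simple'[of "ball z e"]) (auto intro: analytic_imp_holomorphic)
qed

lemma norm_contour_integral_rectpath_le:
  assumes "a \<le> b" "c \<le> d" "0 \<le> B"
    and cont: "continuous_on (path_image (rectpath (Complex a c) (Complex b d))) f"
    and B: "\<And>s. s \<in> path_image (rectpath (Complex a c) (Complex b d)) \<Longrightarrow> norm (f s) \<le> B"
  shows "norm (contour_integral (rectpath (Complex a c) (Complex b d)) f)
           \<le> B * (2 * (b - a) + 2 * (d - c))"
proof -
  define p1 p2 p3 p4 where "p1 = linepath (Complex a c) (Complex b c)"
    and "p2 = linepath (Complex b c) (Complex b d)"
    and "p3 = linepath (Complex b d) (Complex a d)"
    and "p4 = linepath (Complex a d) (Complex a c)"
  note p = p1_def p2_def p3_def p4_def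
  have rp: "rectpath (Complex a c) (Complex b d) = p1 +++ p2 +++ p3 +++ p4"
    by (simp add: rectpath_def p Let_def)
  have im: "path_image (rectpath (Complex a c) (Complex b d))
      = path_image p1 \<union> path_image p2 \<union> path_image p3 \<union> path_image p4"
    unfolding rp by (simp add: path_image_join p Un_assoc)
  have int: "f contour_integrable_on p1" "f contour_integrable_on p2"
    "f contour_integrable_on p3" "f contour_integrable_on p4"
    using cont unfolding im p
    by (auto intro!: contour_integrable_continuous_linepath elim!: continuous_on_subset)
  have bd: "norm (contour_integral p1 f) \<le> B * (b - a)" "norm (contour_integral p2 f) \<le> B * (d - c)"
    "norm (contour_integral p3 f) \<le> B * (b - a)" "norm (contour_integral p4 f) \<le> B * (d - c)"
  proof -
    have bound: "norm (contour_integral (linepath u v) f) \<le> B * norm (v - u)"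
      if "f contour_integrable_on linepath u v"
        "path_image (linepath u v) \<subseteq> path_image (rectpath (Complex a c) (Complex b d))" for u v
      using that B \<open>0 \<le> B\<close> by (intro contour_integral_bound_linepath) auto
    have n: "norm (Complex b c - Complex a c) = b - a" "norm (Complex b d - Complex b c) = d - c"
      "norm (Complex a d - Complex b d) = b - a" "norm (Complex a c - Complex a d) = d - c"
      using assms(1,2) by (simp_all add: cmod_def)
    show "norm (contour_integral p1 f) \<le> B * (b - a)" "norm (contour_integral p2 f) \<le> B * (d - c)"
      "norm (contour_integral p3 f) \<le> B * (b - a)" "norm (contour_integral p4 f) \<le> B * (d - c)"
      using bound[of "Complex a c" "Complex b c"] bound[of "Complex b c" "Complex b d"]
        bound[of "Complex b d" "Complex a d"] bound[of "Complex a d" "Complex a c"] int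
      unfolding im n p by auto
  qed
  have "contour_integral (rectpath (Complex a c) (Complex b d)) f
      = contour_integral p1 f + (contour_integral p2 f + (contour_integral p3 f + contour_integral p4 f))"
    unfolding rp using int
    by (simp add: p contour_integrable_joinI)
  also have "norm \<dots> \<le> norm (contour_integral p1 f) + norm (contour_integral p2 f)
      + norm (contour_integral p3 f) + norm (contour_integral p4 f)"
    by (smt (verit) norm_triangle_ineq)
  also have "\<dots> \<le> B * (2 * (b - a) + 2 * (d - c))"
    using bd by (simp add: algebra_simps)
  finally show ?thesis .
qed

lemma residue_simple_quotient:
  assumes "open S" "a \<in> S" "Q holomorphic_on S" "u holomorphic_on S" "u a \<noteq> 0"
    and "\<And>s. h s = Q s / ((s - a) * u s)"
  shows "residue h a = Q a / u a"
proof -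
  have "isCont u a"
    using assms holomorphic_on_imp_continuous_on continuous_on_eq_continuous_at by blast
  then obtain e where e: "e > 0" "\<And>y. dist a y < e \<Longrightarrow> u y \<noteq> 0"
    using continuous_at_avoid[of a u 0] \<open>u a \<noteq> 0\<close> by auto
  define S' where "S' = S \<inter> ball a e"
  have "(\<lambda>s. Q s / u s) holomorphic_on S'"
  proof (rule holomorphic_on_divide)
    show "Q holomorphic_on S'" "u holomorphic_on S'"
      using assms(3,4) by (auto simp: S'_def elim: holomorphic_on_subset)
  qed (use e in \<open>auto simp: S'_def\<close>)
  moreover have "open S'" "a \<in> S'" using assms e by (auto simp: S'_def)
  ultimately have "residue (\<lambda>s. (Q s / u s) / (s - a)) a = Q a / u a"
    by (intro residue_simple) auto
  moreover have "h = (\<lambda>s. (Q s / u s) / (s - a))"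
    using assms(6) by (auto simp: mult.commute)
  ultimately show ?thesis by simp
qed

text \<open>If \<open>Q\<close> is bounded on the lines \<open>Im s = T n\<close> and outside a vertical strip, then the integral of
  \<open>Q s / ((s - a) * (b - s))\<close> over the boundary of rectangles of size comparable to \<open>T n\<close> tends to \<open>0\<close>,
  since the perimeter grows linearly and the integrand decays quadratically.  Hence the residues at
  the singularities of \<open>Q\<close>, summed along \<open>T\<close>, are balanced by those at \<open>a\<close> and \<open>b\<close>.  The condition
  \<open>T n / \<bar>T (- n)\<bar> \<longlonglongrightarrow> 1\<close> keeps both halves of the rectangle comparable.\<close>

lemma residue_sum_tendsto:
  fixes P :: "complex set" and Q :: "complex \<Rightarrow> complex" and a b K R0 :: real and T :: "int \<Rightarrow> real"
  assumes holo: "Q holomorphic_on (- P)"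
    and fin: "\<And>R. finite (P \<inter> ball 0 R)"
    and away: "\<And>p. p \<in> P \<Longrightarrow> \<bar>Re p\<bar> < R0"
    and off: "\<And>p n. p \<in> P \<Longrightarrow> Im p \<noteq> T n"
    and bound: "\<And>s n. Im s = T n \<or> R0 \<le> \<bar>Re s\<bar> \<Longrightarrow> norm (Q s) \<le> K"
    and ab: "a \<noteq> b" "of_real a \<notin> P" "of_real b \<notin> P"
    and Tpos: "\<And>n. 1 \<le> n \<Longrightarrow> T (- n) < 0 \<and> 0 < T n"
    and Ttop: "filterlim T at_top at_top"
    and Tratio: "((\<lambda>n. T n / \<bar>T (- n)\<bar>) \<longlongrightarrow> 1) at_top"
  shows "(\<lambda>n::nat. \<Sum>p | p \<in> P \<and> T (- int n) < Im p \<and> Im p < T (int n).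
            residue (\<lambda>s. Q s / ((s - of_real a) * (of_real b - s))) p)
          \<longlonglongrightarrow> (Q (of_real b) - Q (of_real a)) / of_real (b - a)"
proof -
  define h where "h s = Q s / ((s - of_real a) * (of_real b - s))" for s
  define F where "F n = (\<Sum>p | p \<in> P \<and> T (- int n) < Im p \<and> Im p < T (int n). residue h p)" for n :: nat
  define L where "L = (Q (of_real b) - Q (of_real a)) / of_real (b - a)"
  have K: "K \<ge> 0" by (rule order.trans[OF norm_ge_zero bound[of "of_real \<bar>R0\<bar>" 0]]) (simp add: abs_ge_self)
  have closedP: "closed P"
  proof -
    have "\<not> z islimpt P" for z
    proof
      assume "z islimpt P"
      then have "infinite (P \<inter> ball z 1)" by (simp add: islimpt_eq_infinite_ball)
      moreover have "P \<inter> ball z 1 \<subseteq> P \<inter> ball 0 (norm z + 1)"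
      proof -
        have "norm x < norm z + 1" if "dist z x < 1" for x
          using that norm_triangle_sub[of x z] by (simp add: dist_norm norm_minus_commute)
        then show ?thesis by auto
      qed
      ultimately show False using fin finite_subset by blast
    qed
    then show ?thesis by (simp add: closed_limpt)
  qed
  have holo_h: "h holomorphic_on (- (P \<union> {of_real a, of_real b}))"
    unfolding h_def by (intro holomorphic_on_divide holomorphic_on_mult holomorphic_on_diff
        holomorphic_on_const holomorphic_on_ident holomorphic_on_subset[OF holo]) auto
  have res_a: "residue h (of_real a) = Q (of_real a) / of_real (b - a)"
  proof -
    have "residue h (of_real a) = Q (of_real a) / (of_real b - of_real a)"
    proof (rule residue_simple_quotient[of "- P"])
      show "(\<lambda>s. of_real b - s) holomorphic_on - P" by (intro holomorphic_intros)
    qed (use closedP holo ab in \<open>auto simp: h_def open_Compl\<close>)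
    then show ?thesis by simp
  qed
  have res_b: "residue h (of_real b) = - Q (of_real b) / of_real (b - a)"
  proof -
    have "residue h (of_real b) = Q (of_real b) / (- (of_real b - of_real a))"
    proof (rule residue_simple_quotient[of "- P"])
      show "(\<lambda>s. - (s - of_real a)) holomorphic_on - P" by (intro holomorphic_intros)
    qed (use closedP holo ab in \<open>auto simp: h_def open_Compl algebra_simps\<close>)
    then show ?thesis by (metis minus_divide_left minus_divide_right of_real_diff)
  qed
  \<comment> \<open>The residue theorem on the rectangle with \<open>\<bar>Re s\<bar> \<le> R\<close> and \<open>- A \<le> Im s \<le> B\<close>.  The two residues at
    \<open>a\<close> and \<open>b\<close> sum to \<open>- L\<close>, and on the boundary the integrand is at most \<open>K / (min A B)\<^sup>2\<close>.\<close>
  have main: "norm (F n - L) \<le> K * (8 * \<bar>A + B\<bar> + 4 * C) / (min A B)\<^sup>2"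
    if n: "1 \<le> n" and A: "A = - T (- int n)" and B: "B = T (int n)"
      and C: "C = \<bar>R0\<bar> + \<bar>a\<bar> + \<bar>b\<bar>" for n A B C
  proof -
    have AB: "A > 0" "B > 0" using Tpos[of "int n"] n A B by auto
    \<comment> \<open>This \<open>R\<close> keeps the vertical sides beyond \<open>R0\<close> and at distance at least \<open>min A B\<close> from \<open>a\<close> and \<open>b\<close>.\<close>
    define R where "R = A + B + C"
    have R: "R > 0" using AB C by (simp add: R_def)
    let ?g = "rectpath (Complex (- R) (- A)) (Complex R B)"
    define M where "M = R + A + B + 1"
    define pts where "pts = (P \<inter> ball 0 M) \<union> {of_real a, of_real b}"
    define In where "In = {p \<in> P. T (- int n) < Im p \<and> Im p < T (int n)}"
    have le: "Re (Complex (- R) (- A)) \<le> Re (Complex R B)" "Im (Complex (- R) (- A)) \<le> Im (Complex R B)"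
      using R AB by auto
    have cb: "cbox (Complex (- R) (- A)) (Complex R B) \<subseteq> ball 0 M"
    proof
      fix z assume "z \<in> cbox (Complex (- R) (- A)) (Complex R B)"
      then have "\<bar>Re z\<bar> \<le> R" "\<bar>Im z\<bar> \<le> A + B"
        using AB by (auto simp: in_cbox_complex_iff)
      then show "z \<in> ball 0 M" using cmod_le[of z] by (simp add: M_def)
    qed
    have edge: "norm (s - of_real a) \<ge> min A B" "norm (of_real b - s) \<ge> min A B" "norm (Q s) \<le> K" "s \<notin> P"
      if "s \<in> path_image ?g" for s
    proof -
      have "s \<in> cbox (Complex (- R) (- A)) (Complex R B) - box (Complex (- R) (- A)) (Complex R B)"
        using that path_image_rectpath_cbox_minus_box[OF le] by simp
      then consider (v) "\<bar>Re s\<bar> = R" | (h) "Im s = T (- int n) \<or> Im s = T (int n)"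
        using A B by (auto simp: in_cbox_complex_iff in_box_complex_iff)
      then have "(norm (s - of_real a) \<ge> min A B \<and> norm (of_real b - s) \<ge> min A B) \<and> norm (Q s) \<le> K \<and> s \<notin> P"
      proof cases
        case v
        have "\<bar>Re (s - of_real a)\<bar> \<ge> min A B" "\<bar>Re (of_real b - s)\<bar> \<ge> min A B"
          using v C AB by (auto simp: R_def)
        then have "norm (s - of_real a) \<ge> min A B" "norm (of_real b - s) \<ge> min A B"
          using abs_Re_le_cmod order_trans by blast+
        moreover have "R0 \<le> \<bar>Re s\<bar>" using v C AB unfolding R_def by linarith
        ultimately show ?thesis using bound away[of s] by fastforce
      next
        case h
        then have "\<bar>Im (s - of_real a)\<bar> \<ge> min A B" "\<bar>Im (of_real b - s)\<bar> \<ge> min A B"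
          using A B by auto
        then have "norm (s - of_real a) \<ge> min A B" "norm (of_real b - s) \<ge> min A B"
          using abs_Im_le_cmod order_trans by blast+
        then show ?thesis using bound h off by blast
      qed
      then show "norm (s - of_real a) \<ge> min A B" "norm (of_real b - s) \<ge> min A B" "norm (Q s) \<le> K" "s \<notin> P"
        by auto
    qed
    have mAB: "min A B > 0" using AB by simp
    have avoid: "path_image ?g \<inter> (P \<union> {of_real a, of_real b}) = {}"
      using edge mAB by force
    have hb: "norm (h s) \<le> K / (min A B)\<^sup>2" if "s \<in> path_image ?g" for s
    proof -
      have "(min A B)\<^sup>2 \<le> norm ((s - of_real a) * (of_real b - s))"
        unfolding norm_mult power2_eq_square using edge[OF that] mAB by (intro mult_mono) auto
      then show ?thesis
        unfolding h_def norm_divide using edge(3)[OF that] mAB K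
        by (intro frac_le) auto
    qed
    have finpts: "finite pts" using fin by (simp add: pts_def)
    have InP: "In \<subseteq> P \<inter> ball 0 M" "In \<subseteq> box (Complex (- R) (- A)) (Complex R B)"
    proof -
      show box: "In \<subseteq> box (Complex (- R) (- A)) (Complex R B)"
      proof
        fix p assume p: "p \<in> In"
        then have "\<bar>Re p\<bar> < R" using away[of p] AB C by (auto simp: In_def R_def)
        with p show "p \<in> box (Complex (- R) (- A)) (Complex R B)"
          by (auto simp: In_def in_box_complex_iff A B)
      qed
      show "In \<subseteq> P \<inter> ball 0 M"
      proof -
        have "In \<subseteq> ball 0 M" using box box_subset_cbox cb by blast
        then show ?thesis by (auto simp: In_def)
      qed
    qed
    have "contour_integral ?g h = 2 * pi * \<i> * (\<Sum>p\<in>pts. winding_number ?g p * residue h p)"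
    proof (rule Residue_theorem[of "ball 0 M"])
      show "h holomorphic_on ball 0 M - pts"
        by (rule holomorphic_on_subset[OF holo_h]) (auto simp: pts_def)
      show "path_image ?g \<subseteq> ball 0 M - pts"
        using path_image_rectpath_subset_cbox[OF le] cb avoid by (auto simp: pts_def)
      show "\<forall>z. z \<notin> ball 0 M \<longrightarrow> winding_number ?g z = 0"
        using cb by (auto intro!: winding_number_rectpath_outside[OF le])
    qed (use finpts in auto)
    also have "(\<Sum>p\<in>pts. winding_number ?g p * residue h p)
        = (\<Sum>p\<in>In \<union> {of_real a, of_real b}. residue h p)"
    proof -
      have inside: "winding_number ?g p = 1" if "p \<in> In \<union> {of_real a, of_real b}" for p
      proof (rule winding_number_rectpath)
        show "p \<in> box (Complex (- R) (- A)) (Complex R B)"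
          using that InP(2) AB C by (auto simp: in_box_complex_iff R_def)
      qed
      have outside: "winding_number ?g p = 0" if "p \<in> pts - (In \<union> {of_real a, of_real b})" for p
      proof (rule winding_number_rectpath_outside[OF le])
        have "p \<in> P" "p \<notin> In" using that by (auto simp: pts_def)
        then have "Im p < T (- int n) \<or> T (int n) < Im p"
          using off[of p "int n"] off[of p "- int n"] by (auto simp: In_def)
        then show "p \<notin> cbox (Complex (- R) (- A)) (Complex R B)"
          using A B by (auto simp: in_cbox_complex_iff)
      qed
      have "(\<Sum>p\<in>pts. winding_number ?g p * residue h p)
          = (\<Sum>p\<in>In \<union> {of_real a, of_real b}. winding_number ?g p * residue h p)"
        using InP(1) outside by (intro sum.mono_neutral_right finpts) (auto simp: pts_def)
      also have "\<dots> = (\<Sum>p\<in>In \<union> {of_real a, of_real b}. residue h p)"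
        by (intro sum.cong refl) (simp add: inside)
      finally show ?thesis .
    qed
    also have "\<dots> = F n - L"
    proof -
      have "finite In" using InP(1) fin finite_subset by blast
      moreover have "In \<inter> {of_real a, of_real b} = {}" using ab by (auto simp: In_def)
      ultimately have "(\<Sum>p\<in>In \<union> {of_real a, of_real b}. residue h p)
          = (\<Sum>p\<in>In. residue h p) + (\<Sum>p\<in>{of_real a, of_real b}. residue h p)"
        by (intro sum.union_disjoint) auto
      also have "(\<Sum>p\<in>{of_real a, of_real b}. residue h p) = - L"
        using ab by (simp add: res_a res_b L_def diff_divide_distrib)
      finally show ?thesis by (simp add: F_def In_def)
    qed
    finally have eq: "contour_integral ?g h = 2 * pi * \<i> * (F n - L)" .
    have "norm (contour_integral ?g h) \<le> K / (min A B)\<^sup>2 * (2 * (R - - R) + 2 * (B - - A))"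
    proof (rule norm_contour_integral_rectpath_le)
      show "continuous_on (path_image ?g) h"
        using avoid by (intro holomorphic_on_imp_continuous_on holomorphic_on_subset[OF holo_h]) auto
    qed (use R AB K hb in auto)
    note * = this
    have "2 * pi * norm (F n - L) \<le> K / (min A B)\<^sup>2 * (4 * R + 2 * (A + B))"
    proof -
      have "norm (2 * complex_of_real pi * \<i> * (F n - L)) = 2 * pi * norm (F n - L)"
        by (simp only: norm_mult) simp
      moreover have "2 * (R - - R) + 2 * (B - - A) = 4 * R + 2 * (A + B)" by simp
      ultimately show ?thesis using * unfolding eq by (simp add: add_ac)
    qed
    moreover have "norm (F n - L) \<le> 2 * pi * norm (F n - L)"
      using pi_ge_two by (intro mult_le_cancel_right1[THEN iffD2]) auto
    moreover have "K / (min A B)\<^sup>2 * (4 * R + 2 * (A + B)) \<le> K / (min A B)\<^sup>2 * (8 * \<bar>A + B\<bar> + 4 * C)"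
      using AB K by (intro mult_left_mono) (auto simp: R_def)
    ultimately show ?thesis by simp
  qed
  define C where "C = \<bar>R0\<bar> + \<bar>a\<bar> + \<bar>b\<bar>"
  define B where "B n = T (int n)" for n :: nat
  define A where "A n = - T (- int n)" for n :: nat
  have top: "filterlim B at_top sequentially"
    unfolding B_def by (rule filterlim_compose[OF Ttop filterlim_int_sequentially])
  have ratio: "(\<lambda>n. B n / \<bar>A n\<bar>) \<longlonglongrightarrow> 1"
    using filterlim_compose[OF Tratio filterlim_int_sequentially] by (simp add: A_def B_def)
  have ev: "\<forall>\<^sub>F n in sequentially. norm (F n - L) \<le> 96 * K * inverse (B n) + 16 * K * C * (inverse (B n))\<^sup>2"
    using eventually_ge_at_top[of 1] order_tendstoD(1)[OF ratio, of "1/2", simplified]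
      order_tendstoD(2)[OF ratio, of 2, simplified]
  proof eventually_elim
    case (elim n)
    have AB: "A n > 0" "B n > 0" using Tpos[of "int n"] elim(1) by (auto simp: A_def B_def)
    have le: "A n \<le> 2 * B n" "B n \<le> 2 * A n" using elim(2,3) AB by (auto simp: field_simps)
    have C: "C \<ge> 0" by (simp add: C_def)
    have m: "B n / 2 \<le> min (A n) (B n)" using le AB by simp
    have "norm (F n - L) \<le> K * (8 * \<bar>A n + B n\<bar> + 4 * C) / (min (A n) (B n))\<^sup>2"
      using main[OF elim(1) A_def B_def C_def] .
    also have "\<dots> \<le> K * (24 * B n + 4 * C) / (B n / 2)\<^sup>2"
      using K AB le C m by (intro frac_le mult_left_mono power_mono mult_nonneg_nonneg) auto
    also have "\<dots> = 96 * K * inverse (B n) + 16 * K * C * (inverse (B n))\<^sup>2"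
      using AB by (simp add: field_simps power2_eq_square)
    finally show ?case .
  qed
  have "(\<lambda>n. 96 * K * inverse (B n) + 16 * K * C * (inverse (B n))\<^sup>2)
      \<longlonglongrightarrow> 96 * K * 0 + 16 * K * C * 0\<^sup>2"
    by (intro tendsto_intros tendsto_inverse_0_at_top[OF top])
  then have "(\<lambda>n. F n - L) \<longlonglongrightarrow> 0"
    using Lim_null_comparison[OF ev] by simp
  then have "F \<longlonglongrightarrow> L" by (simp add: LIM_zero_iff)
  then show ?thesis unfolding F_def[abs_def] L_def h_def[abs_def] .
qed

section \<open>The sum over the complex dimensions\<close>

context
  fixes N d :: nat and r :: "nat \<Rightarrow> real" and W :: "nat \<Rightarrow> nat list" and l :: "nat \<Rightarrow> real"
    and T :: "int \<Rightarrow> real"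
  assumes N: "1 \<le> N" and r: "\<forall>n\<in>{1..N}. 0 < r n \<and> r n < 1"
    and ord: "word_ordering N r W" and l: "l = word_string r W"
    and summ: "summable (\<lambda>i. l (Suc i) ^ d)"
    and simple: "tubular_poles_simple d l"
    and lang: "languid_sequence l T"
begin

text \<open>The value of \<open>string_zeta l\<close> at a pole is \<open>0\<close>, so the bound on the line \<open>Im s = T n\<close> does not exclude
  a pole there by itself; the values near the pole on the line do.\<close>

lemma Im_complex_dim_neq:
  assumes "\<omega> \<in> complex_dims l"
  shows "Im \<omega> \<noteq> T n"
proof
  assume Im: "Im \<omega> = T n"
  obtain c where c: "\<And>\<alpha> n. norm (string_zeta l (Complex \<alpha> (T n))) \<le> c"
    using lang by (auto simp: languid_sequence_def)
  have "filterlim (\<lambda>s. norm (string_zeta l s)) at_top (at \<omega>)"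
    using assms filterlim_at_infinity_imp_norm_at_top by (auto simp: complex_dims_def is_pole_def)
  then have "\<forall>\<^sub>F s in at \<omega>. c < norm (string_zeta l s)"
    by (simp add: filterlim_at_top_dense)
  then obtain \<delta> where \<delta>: "\<delta> > 0" "\<And>s. s \<noteq> \<omega> \<Longrightarrow> dist s \<omega> < \<delta> \<Longrightarrow> c < norm (string_zeta l s)"
    by (auto simp: eventually_at)
  have "c < norm (string_zeta l (Complex (Re \<omega> + \<delta> / 2) (T n)))"
    using \<delta>(1) by (intro \<delta>(2)) (auto simp: complex_eq_iff dist_norm cmod_def Im)
  with c show False by (simp add: not_less[symmetric])
qed

text \<open>The analytic core.  Here \<open>J\<close> separates the terms of the string with \<open>l j > x\<close>, whose powers
  \<open>(l j / x) powr s\<close> are bounded on the left half plane \<open>Re s \<le> d\<close>, from those with \<open>l j \<le> x\<close>, whose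
  powers are bounded on the right half plane.  After subtraction of the former, \<open>D s * x powr (- s)\<close> is
  bounded on both sides and along \<open>T\<close>.\<close>

proposition complex_dims_sum_tendsto:
  fixes x :: real and J k :: nat
  defines "D s \<equiv> string_zeta l s - (\<Sum>j=1..J. of_real (l j) powr s)"
  assumes x: "0 < x" "x < 1" and k: "k < d"
    and J: "\<And>j. 1 \<le> j \<Longrightarrow> j \<le> J \<longleftrightarrow> x < l j"
  shows "(\<lambda>n::nat. \<Sum>\<omega> | \<omega> \<in> complex_dims l \<and> T (- int n) < Im \<omega> \<and> Im \<omega> < T (int n).
             residue (string_zeta l) \<omega> * of_real x powr (- \<omega>) / ((\<omega> - of_nat k) * (of_nat d - \<omega>)))
           \<longlonglongrightarrow> (D (of_nat d) * of_real x powr (- of_nat d) - D (of_nat k) * of_real x powr (- of_nat k))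
                 / of_nat (d - k)"
proof -
  note facts = r ord l summ
  define \<zeta> where "\<zeta> s = inverse (1 - ratio_sum N r s)" for s
  have \<zeta>: "string_zeta l = \<zeta>" using string_zeta_eq[OF facts] by (simp add: \<zeta>_def[abs_def])
  define P where "P = complex_dims l"
  have P: "P = {s. ratio_sum N r s = 1}" using complex_dims_eq[OF facts] by (simp add: P_def)
  define Z where "Z s = (\<Sum>j=1..J. complex_of_real (l j) powr s)" for s
  define Q where "Q s = (\<zeta> s - Z s) * of_real x powr (- s)" for s
  have lpos: "0 < l j" if "1 \<le> j" for j using word_string_bounds(1)[OF facts, of "j - 1"] that by simp
  have holo_pow: "(\<lambda>s. complex_of_real a powr s) holomorphic_on A" if "0 < a" for a A
    using that by (simp add: of_real_powr_eq_exp) (intro holomorphic_intros)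
  have holo_Z: "Z holomorphic_on A" for A
    unfolding Z_def[abs_def] using lpos by (intro holomorphic_on_sum holo_pow) auto
  have holo_x: "(\<lambda>s. of_real x powr (- s)) holomorphic_on A" for A
    using x(1) by (simp add: of_real_powr_eq_exp) (intro holomorphic_intros)
  have holo_rs: "(\<lambda>s. 1 - ratio_sum N r s) holomorphic_on A" for A
    using r by (intro holomorphic_on_diff holomorphic_on_const ratio_sum_holomorphic) auto
  have holo_Q: "Q holomorphic_on (- P)"
    unfolding Q_def[abs_def] \<zeta>_def[abs_def]
    by (intro holomorphic_on_mult holomorphic_on_diff holo_Z holo_x holomorphic_on_inverse holo_rs)
      (auto simp: P)
  obtain M where M: "\<And>s. Re s \<le> - M \<Longrightarrow> 1 / 2 \<le> norm (1 - ratio_sum N r s)"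
    using ratio_sum_left_bound[OF N r] by blast
  obtain c where c: "\<And>\<alpha> n. norm (\<zeta> (Complex \<alpha> (T n))) \<le> c"
    using lang unfolding languid_sequence_def \<zeta> by auto
  define R0 where "R0 = \<bar>M\<bar> + real d + 1"
  have Re_P: "- M < Re p" "Re p < real d" if "p \<in> P" for p
  proof -
    show "Re p < real d" using zeta_series(1)[OF facts, of p] that by (fastforce simp: P)
    show "- M < Re p" using M[of p] that by (force simp: P)
  qed
  have away: "\<bar>Re p\<bar> < R0" if "p \<in> P" for p
    using Re_P[OF that] by (simp add: R0_def)
  have npow: "norm (complex_of_real a powr s * of_real x powr (- s)) = (a / x) powr Re s" if "0 < a" for a s
    using that x(1) by (simp add: norm_mult norm_of_real_powr powr_divide powr_minus_divide[of x "Re s"])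
  \<comment> \<open>For \<open>Re s \<ge> d\<close> only the terms with \<open>l j / x \<le> 1\<close> are left in the convergent series.\<close>
  define K1 where "K1 = (\<Sum>i. (l (Suc (i + J)) / x) ^ d)"
  have summ1: "summable (\<lambda>i. (l (Suc (i + J)) / x) ^ d)"
    using summable_ignore_initial_segment[OF summ, of J]
    by (simp add: power_divide summable_divide)
  have right: "norm (Q s) \<le> K1" if s: "real d \<le> Re s" for s
  proof -
    have "(\<lambda>i. complex_of_real (l (Suc (i + J))) powr s) sums (\<zeta> s - (\<Sum>i<J. of_real (l (Suc i)) powr s))"
      using zeta_series(3)[OF facts s] unfolding \<zeta>_def by (rule sums_split_initial_segment)
    moreover have "(\<Sum>i<J. complex_of_real (l (Suc i)) powr s) = Z s"
      unfolding Z_def by (rule sum.reindex_bij_witness[of _ "\<lambda>j. j - 1" Suc]) auto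
    ultimately have "(\<lambda>i. complex_of_real (l (Suc (i + J))) powr s * of_real x powr (- s)) sums Q s"
      unfolding Q_def by (metis sums_mult2)
    then have "Q s = (\<Sum>i. complex_of_real (l (Suc (i + J))) powr s * of_real x powr (- s))"
      by (simp add: sums_iff)
    also have "norm \<dots> \<le> K1" unfolding K1_def
    proof (rule norm_suminf_le[OF _ summ1])
      fix i
      have lp: "0 < l (Suc (i + J))" using lpos by simp
      have "l (Suc (i + J)) \<le> x" using J[of "Suc (i + J)"] by simp
      then have "l (Suc (i + J)) / x \<le> 1" using x by simp
      then have "(l (Suc (i + J)) / x) powr Re s \<le> (l (Suc (i + J)) / x) powr real d"
        using s lp x by (intro powr_mono') auto
      then show "norm (complex_of_real (l (Suc (i + J))) powr s * of_real x powr (- s))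
          \<le> (l (Suc (i + J)) / x) ^ d"
        using lp x by (simp add: npow powr_realpow)
    qed
    finally show ?thesis .
  qed
  \<comment> \<open>For \<open>Re s \<le> d\<close> the factor \<open>x powr (- s)\<close> is bounded because \<open>x < 1\<close>, and the finitely many
    subtracted terms because \<open>l j / x > 1\<close>.\<close>
  define K2 where "K2 = (\<Sum>j=1..J. (l j / x) ^ d)"
  have left: "norm (Q s) \<le> max c 2 * x powr (- real d) + K2"
    if s: "Re s \<le> real d" and z: "norm (\<zeta> s) \<le> max c 2" for s
  proof -
    have "Q s = \<zeta> s * of_real x powr (- s) - (\<Sum>j=1..J. complex_of_real (l j) powr s * of_real x powr (- s))"
      by (simp add: Q_def Z_def left_diff_distrib sum_distrib_right)
    then have "norm (Q s) \<le> norm (\<zeta> s * of_real x powr (- s))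
        + norm (\<Sum>j=1..J. complex_of_real (l j) powr s * of_real x powr (- s))"
      by (simp only: norm_triangle_ineq4)
    also have "norm (\<zeta> s * of_real x powr (- s)) \<le> max c 2 * x powr (- real d)"
      unfolding norm_mult
    proof (rule mult_mono[OF z])
      show "norm (complex_of_real x powr (- s)) \<le> x powr (- real d)"
        using x s by (simp add: norm_of_real_powr powr_mono')
    qed auto
    also have "norm (\<Sum>j=1..J. complex_of_real (l j) powr s * of_real x powr (- s)) \<le> K2"
      unfolding K2_def
    proof (rule sum_norm_le)
      fix j assume "j \<in> {1..J}"
      then have j: "x < l j" "0 < l j" using J[of j] lpos by auto
      then have "1 \<le> l j / x" using x by simp
      then have "(l j / x) powr Re s \<le> (l j / x) powr real d" using s by (intro powr_mono) auto
      then show "norm (complex_of_real (l j) powr s * of_real x powr (- s)) \<le> (l j / x) ^ d"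
        using j x by (simp add: npow powr_realpow)
    qed
    finally show ?thesis by simp
  qed
  have bound: "norm (Q s) \<le> max K1 (max c 2 * x powr (- real d) + K2)"
    if "Im s = T n \<or> R0 \<le> \<bar>Re s\<bar>" for s n
  proof (cases "real d \<le> Re s")
    case True
    then show ?thesis using right by (simp add: le_max_iff_disj)
  next
    case False
    have "norm (\<zeta> s) \<le> max c 2"
    proof (cases "Im s = T n")
      case True
      then show ?thesis using c[of "Re s" n] by (simp add: complex_eq_iff le_max_iff_disj flip: True)
    next
      case nT: False
      then have "Re s \<le> - M" using that False by (simp add: R0_def)
      then have "1 / 2 \<le> norm (1 - ratio_sum N r s)" by (rule M)
      then have "inverse (norm (1 - ratio_sum N r s)) \<le> inverse (1 / 2)"
        by (intro le_imp_inverse_le) auto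
      then show ?thesis by (simp add: \<zeta>_def norm_inverse le_max_iff_disj)
    qed
    then show ?thesis using left[of s] False by (simp add: le_max_iff_disj)
  qed
  have notP: "of_real (real m) \<notin> P" if "m \<le> d" for m
    using simple that by (auto simp: tubular_poles_simple_def P_def)
  have lim: "(\<lambda>n::nat. \<Sum>p | p \<in> P \<and> T (- int n) < Im p \<and> Im p < T (int n).
      residue (\<lambda>s. Q s / ((s - of_real (real k)) * (of_real (real d) - s))) p)
    \<longlonglongrightarrow> (Q (of_real (real d)) - Q (of_real (real k))) / of_real (real d - real k)"
  proof (rule residue_sum_tendsto[of Q P R0 T
        "max K1 (max c 2 * x powr (- real d) + K2)" "real k" "real d"])
    show "finite (P \<inter> ball 0 R)" for R
      using finite_complex_dims_bounded[OF facts] by (simp add: P_def)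
    show "Im p \<noteq> T n" if "p \<in> P" for p n using that Im_complex_dim_neq by (simp add: P_def)
    show "norm (Q s) \<le> max K1 (max c 2 * x powr (- real d) + K2)"
      if "Im s = T n \<or> R0 \<le> \<bar>Re s\<bar>" for s n by (rule bound[OF that])
  qed (use lang k holo_Q away notP in \<open>auto simp: languid_sequence_def\<close>)
  have res: "residue (\<lambda>s. Q s / ((s - of_real (real k)) * (of_real (real d) - s))) \<omega>
      = residue \<zeta> \<omega> * of_real x powr (- \<omega>) / ((\<omega> - of_nat k) * (of_nat d - \<omega>))"
    if \<omega>: "\<omega> \<in> P" for \<omega>
  proof (rule residue_eq_limit)
    have nk: "\<omega> \<noteq> of_nat k" "\<omega> \<noteq> of_nat d" using \<omega> notP[of k] notP[of d] k by auto
    have mero: "\<zeta> meromorphic_on {\<omega>}"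
      using nicely_meromorphic_zeta[OF facts] meromorphic_on_subset
      unfolding \<zeta>_def[abs_def] nicely_meromorphic_on_def by blast
    have ana: "f analytic_on {\<omega>}" if "f holomorphic_on UNIV" for f
      using that by (meson analytic_on_open analytic_on_subset open_UNIV subset_UNIV)
    show "(\<lambda>s. Q s / ((s - of_real (real k)) * (of_real (real d) - s))) meromorphic_on {\<omega>}"
      unfolding Q_def[abs_def]
      by (intro meromorphic_intros mero analytic_on_imp_meromorphic_on ana holo_Z holo_x)
    have "is_pole \<zeta> \<omega>" "zorder \<zeta> \<omega> = - 1"
      using \<omega> simple unfolding P_def complex_dims_def tubular_poles_simple_def \<zeta> by auto
    then have l1: "((\<lambda>w. \<zeta> w * (w - \<omega>)) \<longlongrightarrow> residue \<zeta> \<omega>) (at \<omega>)"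
      using tendsto_residue_simple_pole[OF mero] by simp
    have lz: "(Z \<longlongrightarrow> Z \<omega>) (at \<omega>)" and lx: "((\<lambda>s. of_real x powr (- s)) \<longlongrightarrow> of_real x powr (- \<omega>)) (at \<omega>)"
      using ana[OF holo_Z] ana[OF holo_x] analytic_at_imp_isCont isContD by blast+
    have "((\<lambda>w. (\<zeta> w * (w - \<omega>) - Z w * (w - \<omega>)) * of_real x powr (- w) / ((w - of_nat k) * (of_nat d - w)))
        \<longlongrightarrow> (residue \<zeta> \<omega> - Z \<omega> * (\<omega> - \<omega>)) * of_real x powr (- \<omega>) / ((\<omega> - of_nat k) * (of_nat d - \<omega>))) (at \<omega>)"
      using nk by (intro tendsto_intros l1 lz lx) auto
    then show "((\<lambda>w. Q w / ((w - of_real (real k)) * (of_real (real d) - w)) * (w - \<omega>))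
        \<longlongrightarrow> residue \<zeta> \<omega> * of_real x powr (- \<omega>) / ((\<omega> - of_nat k) * (of_nat d - \<omega>))) (at \<omega>)"
      by (simp add: Q_def algebra_simps)
  qed
  have "(\<lambda>n::nat. \<Sum>\<omega> | \<omega> \<in> P \<and> T (- int n) < Im \<omega> \<and> Im \<omega> < T (int n).
      residue \<zeta> \<omega> * of_real x powr (- \<omega>) / ((\<omega> - of_nat k) * (of_nat d - \<omega>)))
    \<longlonglongrightarrow> (Q (of_real (real d)) - Q (of_real (real k))) / of_real (real d - real k)"
    using lim by (rule Lim_transform_eventually) (auto intro!: always_eventually sum.cong simp: res[unfolded of_real_of_nat_eq])
  then show ?thesis
    using k unfolding D_def \<zeta> P_def Q_def Z_def by (simp add: of_nat_diff)
qed

end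

section \<open>The tube formula\<close>

text \<open>The set in the definition of \<open>last_large\<close> is finite and an initial segment of the positive
  integers, since the string decreases to \<open>0\<close>.\<close>

lemma last_large_iff:
  assumes mono: "antimono_on {1..} l" and lim: "(\<lambda>i. l (Suc i)) \<longlonglongrightarrow> 0"
    and pos: "\<And>i. 0 < l (Suc i)" and "0 < g" "0 < \<epsilon>" "1 \<le> j"
  shows "j \<le> last_large g l \<epsilon> \<longleftrightarrow> \<epsilon> / g < l j"
proof -
  define E where "E = {j. 1 \<le> j \<and> inverse (l j) * \<epsilon> < g}"
  have lp: "0 < l j" if "1 \<le> j" for j using pos[of "j - 1"] that by simp
  have E: "j \<in> E \<longleftrightarrow> 1 \<le> j \<and> \<epsilon> / g < l j" for j
    using lp[of j] \<open>0 < g\<close> by (auto simp: E_def field_simps)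
  have "\<forall>\<^sub>F i in sequentially. l (Suc i) < \<epsilon> / g"
    using lim assms(4,5) by (intro order_tendstoD(2)) auto
  then obtain m where m: "\<And>i. m \<le> i \<Longrightarrow> l (Suc i) < \<epsilon> / g"
    by (auto simp: eventually_sequentially)
  have "E \<subseteq> {..m}"
  proof
    fix j assume "j \<in> E"
    then have "\<not> m \<le> j - 1" using m[of "j - 1"] by (auto simp: E)
    then show "j \<in> {..m}" by simp
  qed
  then have fin: "finite (E \<union> {0})" using finite_subset by auto
  have J: "last_large g l \<epsilon> = Max (E \<union> {0})" by (simp add: last_large_def E_def)
  show ?thesis
  proof
    assume "j \<le> last_large g l \<epsilon>"
    moreover have "last_large g l \<epsilon> \<in> E \<union> {0}" unfolding J using fin by (intro Max_in) auto
    ultimately have "last_large g l \<epsilon> \<in> E" using \<open>1 \<le> j\<close> by auto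
    moreover have "l (last_large g l \<epsilon>) \<le> l j"
      using mono \<open>j \<le> _\<close> \<open>1 \<le> j\<close> by (auto simp: monotone_on_def)
    ultimately show "\<epsilon> / g < l j" by (auto simp: E)
  next
    assume "\<epsilon> / g < l j"
    then have "j \<in> E \<union> {0}" using \<open>1 \<le> j\<close> by (simp add: E)
    then show "j \<le> last_large g l \<epsilon>" unfolding J using fin by (intro Max_ge) auto
  qed
qed

text \<open>The term of a complex dimension, written in the form to which \<open>complex_dims_sum_tendsto\<close> applies.\<close>

lemma coeff_dim_term:
  assumes "0 < \<epsilon>" "0 < g"
  shows "coeff_dim d g l \<kappa> \<omega> * complex_of_real \<epsilon> powr (of_nat d - \<omega>)
    = (\<Sum>k<d. of_real (\<kappa> k g * real (d - k) * \<epsilon> ^ d / g ^ k) *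
        (residue (string_zeta l) \<omega> * of_real (\<epsilon> / g) powr (- \<omega>) / ((\<omega> - of_nat k) * (of_nat d - \<omega>))))"
proof -
  have quot: "complex_of_real (\<epsilon> / g) powr (- \<omega>) = of_real g powr \<omega> * of_real \<epsilon> powr (- \<omega>)"
    using assms of_real_powr_eq_exp[of "\<epsilon> / g" "- \<omega>"]
    by (simp add: of_real_powr_eq_exp ln_div algebra_simps flip: exp_add del: of_real_divide)
  have pw: "complex_of_real g powr (\<omega> - of_nat k) * of_real \<epsilon> powr (of_nat d - \<omega>)
      = of_real (\<epsilon> ^ d / g ^ k) * of_real (\<epsilon> / g) powr (- \<omega>)" for k
  proof -
    have "complex_of_real g powr (\<omega> - of_nat k) = of_real g powr \<omega> / of_real g ^ k"
      using assms by (simp add: powr_diff of_real_powr_of_nat)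
    moreover have "complex_of_real \<epsilon> powr (of_nat d - \<omega>) = of_real \<epsilon> ^ d * of_real \<epsilon> powr (- \<omega>)"
      using assms powr_add[of "complex_of_real \<epsilon>" "of_nat d" "- \<omega>"] by (simp add: of_real_powr_of_nat)
    ultimately show ?thesis unfolding quot by simp
  qed
  have "coeff_dim d g l \<kappa> \<omega> * complex_of_real \<epsilon> powr (of_nat d - \<omega>)
      = (\<Sum>k<d. residue (string_zeta l) \<omega> / (of_nat d - \<omega>) * (of_nat (d - k) / (\<omega> - of_nat k)) * of_real (\<kappa> k g)
          * (complex_of_real g powr (\<omega> - of_nat k) * of_real \<epsilon> powr (of_nat d - \<omega>)))"
    unfolding coeff_dim_def by (simp add: sum_distrib_left sum_distrib_right mult_ac)
  also have "\<dots> = (\<Sum>k<d. of_real (\<kappa> k g * real (d - k) * \<epsilon> ^ d / g ^ k) *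
        (residue (string_zeta l) \<omega> * of_real (\<epsilon> / g) powr (- \<omega>) / ((\<omega> - of_nat k) * (of_nat d - \<omega>))))"
    unfolding pw by (intro sum.cong refl) (simp del: of_real_divide add: of_real_divide[of _ "g ^ _"] mult_ac)
  finally show ?thesis .
qed

theorem corollary5p9:
  fixes \<Phi> :: "nat \<Rightarrow> 'a::euclidean_space \<Rightarrow> 'a"
    and N :: nat and r :: "nat \<Rightarrow> real"
    and U G :: "'a set"
    and W :: "nat \<Rightarrow> nat list"
    and l :: "nat \<Rightarrow> real"
    and \<kappa> :: "nat \<Rightarrow> real \<Rightarrow> real"
    and g \<epsilon> :: real
    and T :: "int \<Rightarrow> real"
  assumes "similarity_system N \<Phi> r"
    and "feasible_open_set N \<Phi> U"
    and "nontrivial_system N \<Phi>"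
    and "generators N \<Phi> U = {G}"
    and "word_ordering N r W"
    and "l = word_string r W"
    and "g = inradius G"
    and "steiner_like G \<kappa>"
    and "tubular_poles_simple DIM('a) l"
    and "languid_sequence l T"
    and "0 < \<epsilon>" and "\<epsilon> < g"
  shows "\<exists>S. dims_sum_to l T
               (\<lambda>\<omega>. coeff_dim DIM('a) g l \<kappa> \<omega> * complex_of_real \<epsilon> powr (of_nat DIM('a) - \<omega>)) S
           \<and> complex_of_real (tiling_inner_volume (self_similar_tiling N \<Phi> U) \<epsilon>)
               = S + (\<Sum>k=0..DIM('a). (coeff_int g l \<kappa> k + of_real (coeff_err g l \<kappa> k \<epsilon>))
                                        * complex_of_real \<epsilon> ^ (DIM('a) - k))
           \<and> complex_of_real (tiling_inner_volume (self_similar_tiling N \<Phi> U) \<epsilon>)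
               = S + (\<Sum>k=0..DIM('a). coeff_total g l \<kappa> k \<epsilon>
                                        * complex_of_real \<epsilon> ^ (DIM('a) - k))"
proof -
  define d where "d = DIM('a)"
  define vol where "vol = measure lebesgue G"
  define V where "V = tiling_inner_volume (self_similar_tiling N \<Phi> U) \<epsilon>"
  have N: "1 \<le> N" and rb: "\<forall>n\<in>{1..N}. 0 < r n \<and> r n < 1"
    using assms(1) by (auto simp: similarity_system_def contractive_similarity_def)
  note G = generator_properties[OF assms(1,2,4)]
  have V: "(\<lambda>i. l (Suc i) ^ d * inner_volume G (\<epsilon> / l (Suc i))) sums V"
    and summ: "summable (\<lambda>i. l (Suc i) ^ d)"
    using tiling_volume_sums[OF assms(1,2,4,5,6)] by (auto simp: d_def V_def)
  note facts = rb assms(5,6) summ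
  have g: "0 < g" using assms by simp
  define x where "x = \<epsilon> / g"
  have x: "0 < x" "x < 1" using assms g by (auto simp: x_def)
  have lpos: "0 < l j" if "1 \<le> j" for j using word_string_bounds(1)[OF facts, of "j - 1"] that by simp
  define J where "J = last_large g l \<epsilon>"
  have lim: "(\<lambda>i. l (Suc i)) \<longlonglongrightarrow> 0"
    using summable_LIMSEQ_zero[OF summ] by (simp add: d_def power_tendsto_0_iff)
  have J: "j \<le> J \<longleftrightarrow> x < l j" if "1 \<le> j" for j
    unfolding J_def x_def using assms(5,6,11) lpos g that lim
    by (intro last_large_iff) (auto simp: word_ordering_def)
  define z where "z k = (\<Sum>j=1..J. l j ^ k)" for k
  define \<zeta> where "\<zeta> = string_zeta l"
  define D where "D k = \<zeta> (of_nat k) - of_real (z k)" for k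
  have zZ: "(\<Sum>j=1..J. complex_of_real (l j) powr of_nat k) = of_real (z k)" for k
    using lpos by (simp add: z_def of_real_powr_of_nat)
  have xpow: "complex_of_real x powr (- of_nat k) = of_real (inverse (x ^ k))" for k
    using x(1) by (simp add: powr_minus of_real_powr_of_nat)

  define In where "In n = {\<omega>. \<omega> \<in> complex_dims l \<and> T (- int n) < Im \<omega> \<and> Im \<omega> < T (int n)}" for n :: nat
  define A where "A k \<omega> = residue \<zeta> \<omega> * of_real x powr (- \<omega>) / ((\<omega> - of_nat k) * (of_nat d - \<omega>))"
    for k :: nat and \<omega>
  define C where "C k = complex_of_real (\<kappa> k g * real (d - k) * \<epsilon> ^ d / g ^ k)" for k
  define S where "S = (\<Sum>k<d. C k * ((D d * of_real (inverse (x ^ d)) - D k * of_real (inverse (x ^ k))) / of_nat (d - k)))"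
  have Alim: "(\<lambda>n. \<Sum>\<omega>\<in>In n. A k \<omega>) \<longlonglongrightarrow> (D d * of_real (inverse (x ^ d)) - D k * of_real (inverse (x ^ k))) / of_nat (d - k)"
    if "k < d" for k
    using complex_dims_sum_tendsto[OF N facts assms(9)[folded d_def] assms(10) x that J]
    unfolding zZ xpow A_def In_def D_def \<zeta>_def .
  have "(\<lambda>n. \<Sum>\<omega>\<in>In n. coeff_dim d g l \<kappa> \<omega> * complex_of_real \<epsilon> powr (of_nat d - \<omega>))
      = (\<lambda>n. \<Sum>k<d. C k * (\<Sum>\<omega>\<in>In n. A k \<omega>))"
    unfolding coeff_dim_term[OF assms(11) g] C_def A_def \<zeta>_def x_def sum_distrib_left
    by (intro ext sum.swap)
  also have "\<dots> \<longlonglongrightarrow> S"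
    unfolding S_def by (intro tendsto_sum tendsto_mult tendsto_const Alim) auto
  finally have dims: "dims_sum_to l T (\<lambda>\<omega>. coeff_dim d g l \<kappa> \<omega> * complex_of_real \<epsilon> powr (of_nat d - \<omega>)) S"
    by (simp add: dims_sum_to_def In_def)
  \<comment> \<open>The summand for \<open>k = d\<close> vanishes, so the sum may be extended to it.\<close>
  have S: "S = (\<Sum>k=0..d. of_real (\<kappa> k g) * (of_real (g ^ (d - k)) * D d - of_real (\<epsilon> ^ (d - k)) * D k))"
  proof -
    have "C k * ((D d * of_real (inverse (x ^ d)) - D k * of_real (inverse (x ^ k))) / of_nat (d - k))
        = of_real (\<kappa> k g) * (of_real (g ^ (d - k)) * D d - of_real (\<epsilon> ^ (d - k)) * D k)" if "k < d" for k
    proof -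
      have 1: "\<epsilon> ^ d / g ^ k * inverse (x ^ d) = g ^ (d - k)" "\<epsilon> ^ d / g ^ k * inverse (x ^ k) = \<epsilon> ^ (d - k)"
        using assms(11) g that by (auto simp: x_def power_divide power_diff field_simps)
      have "C k * ((D d * of_real (inverse (x ^ d)) - D k * of_real (inverse (x ^ k))) / of_nat (d - k))
          = of_real (\<kappa> k g) * (of_real (\<epsilon> ^ d / g ^ k * inverse (x ^ d)) * D d
              - of_real (\<epsilon> ^ d / g ^ k * inverse (x ^ k)) * D k)"
      proof -
        have "(K * m * E) * ((p * a - q * b) / m) = K * (E * a * p - E * b * q)"
          if "m \<noteq> 0" for K m E p a q b :: complex
          using that by (simp add: field_simps)
        from this[of "of_nat (d - k)" "of_real (\<kappa> k g)" "of_real (\<epsilon> ^ d / g ^ k)"] that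
        show ?thesis unfolding C_def by (simp del: of_nat_diff)
      qed
      then show ?thesis unfolding 1 .
    qed
    then have "S = (\<Sum>k<d. of_real (\<kappa> k g) * (of_real (g ^ (d - k)) * D d - of_real (\<epsilon> ^ (d - k)) * D k))"
      unfolding S_def by (intro sum.cong) auto
    also have "\<dots> = (\<Sum>k<Suc d. of_real (\<kappa> k g) * (of_real (g ^ (d - k)) * D d - of_real (\<epsilon> ^ (d - k)) * D k))"
      by simp
    also have "{..<Suc d} = {0..d}" by auto
    finally show ?thesis .
  qed

  have steiner: "inner_volume G \<delta> = (\<Sum>k=0..d. \<kappa> k \<delta> * \<delta> ^ (d - k))" if "0 < \<delta>" "\<delta> \<le> g" for \<delta>
    using assms(7,8) that by (simp add: steiner_like_def d_def)
  have full: "inner_volume G \<delta> = vol" if "g \<le> \<delta>" for \<delta>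
    using inner_parallel_set_eq_self[OF G(2,3)] that assms(7) by (simp add: inner_volume_def vol_def)
  have vol: "vol = (\<Sum>k=0..d. \<kappa> k g * g ^ (d - k))" using steiner[of g] full[of g] g by simp
  define e where "e k = (\<Sum>j=1..J. l j ^ k * \<kappa> k (\<epsilon> / l j))" for k
  have small: "\<epsilon> / l j < g" if "j \<in> {1..J}" for j
    using J[of j] lpos[of j] g that by (auto simp: x_def field_simps)
  have err: "coeff_err g l \<kappa> k \<epsilon> = e k - \<kappa> k g * z k" for k
  proof -
    have "coeff_err g l \<kappa> k \<epsilon> = (\<Sum>j=1..J. l j ^ k * \<kappa> k (\<epsilon> / l j) - \<kappa> k g * l j ^ k)"
      unfolding coeff_err_def J_def[symmetric]
      using small by (intro sum.cong) (auto simp: coeff_extended_def divide_inverse algebra_simps)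
    then show ?thesis by (simp add: e_def z_def sum_subtractf sum_distrib_left)
  qed
  \<comment> \<open>The large tiles, with \<open>j \<le> J\<close>, contribute through the Steiner-like representation \<dots>\<close>
  have head: "(\<Sum>i<J. l (Suc i) ^ d * inner_volume G (\<epsilon> / l (Suc i))) = (\<Sum>k=0..d. e k * \<epsilon> ^ (d - k))"
  proof -
    have "(\<Sum>i<J. l (Suc i) ^ d * inner_volume G (\<epsilon> / l (Suc i))) = (\<Sum>j=1..J. l j ^ d * inner_volume G (\<epsilon> / l j))"
      by (rule sum.reindex_bij_witness[of _ "\<lambda>j. j - 1" Suc]) auto
    also have "\<dots> = (\<Sum>j=1..J. \<Sum>k=0..d. l j ^ k * \<kappa> k (\<epsilon> / l j) * \<epsilon> ^ (d - k))"
    proof (rule sum.cong[OF refl])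
      fix j assume j: "j \<in> {1..J}"
      then have lj: "0 < l j" using lpos by simp
      have eq: "l j ^ d * (\<kappa> k (\<epsilon> / l j) * (\<epsilon> / l j) ^ (d - k)) = l j ^ k * \<kappa> k (\<epsilon> / l j) * \<epsilon> ^ (d - k)"
        if "k \<in> {0..d}" for k
      proof -
        have "l j ^ d = l j ^ k * l j ^ (d - k)" using that by (simp flip: power_add)
        then show ?thesis using lj by (simp add: power_divide)
      qed
      have "0 < \<epsilon> / l j" "\<epsilon> / l j \<le> g" using small[OF j] lj assms(11) by auto
      show "l j ^ d * inner_volume G (\<epsilon> / l j) = (\<Sum>k=0..d. l j ^ k * \<kappa> k (\<epsilon> / l j) * \<epsilon> ^ (d - k))"
        unfolding steiner[OF \<open>0 < \<epsilon> / l j\<close> \<open>\<epsilon> / l j \<le> g\<close>] sum_distrib_left by (intro sum.cong refl eq)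
    qed
    also have "\<dots> = (\<Sum>k=0..d. e k * \<epsilon> ^ (d - k))"
      unfolding e_def sum_distrib_right by (rule sum.swap)
    finally show ?thesis .
  qed
  \<comment> \<open>\<dots> and each small tile is contained in its inner parallel set and contributes its full volume.\<close>
  have tail: "complex_of_real vol * D d = of_real (V - (\<Sum>k=0..d. e k * \<epsilon> ^ (d - k)))"
  proof -
    have "(\<lambda>i. l (Suc (i + J)) ^ d * inner_volume G (\<epsilon> / l (Suc (i + J))))
        sums (V - (\<Sum>k=0..d. e k * \<epsilon> ^ (d - k)))"
      using sums_split_initial_segment[OF V, of J] by (simp add: head)
    moreover have "inner_volume G (\<epsilon> / l (Suc (i + J))) = vol" for i
    proof (rule full)
      have "l (Suc (i + J)) \<le> x" using J[of "Suc (i + J)"] by simp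
      then show "g \<le> \<epsilon> / l (Suc (i + J))"
        using lpos[of "Suc (i + J)"] g by (simp add: x_def field_simps)
    qed
    ultimately have "(\<lambda>i. complex_of_real (l (Suc (i + J)) ^ d * vol))
        sums of_real (V - (\<Sum>k=0..d. e k * \<epsilon> ^ (d - k)))"
      by (simp only: sums_of_real_iff)
    moreover have "(\<lambda>i. complex_of_real (l (Suc (i + J)) ^ d * vol)) sums (D d * of_real vol)"
    proof -
      have "(\<lambda>i. complex_of_real (l (Suc (i + J))) powr of_nat d)
          sums (\<zeta> (of_nat d) - (\<Sum>i<J. complex_of_real (l (Suc i)) powr of_nat d))"
        unfolding \<zeta>_def string_zeta_eq[OF facts]
        by (intro sums_split_initial_segment zeta_series(3)[OF facts]) simp
      also have "(\<Sum>i<J. complex_of_real (l (Suc i)) powr of_nat d) = of_real (z d)"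
        unfolding zZ[symmetric] by (rule sum.reindex_bij_witness[of _ "\<lambda>j. j - 1" Suc]) auto
      finally show ?thesis
        using lpos by (simp add: D_def of_real_powr_of_nat sums_mult2)
    qed
    ultimately show ?thesis using sums_unique2 by (metis mult.commute)
  qed
  have main: "complex_of_real V = S + (\<Sum>k=0..d. (coeff_int g l \<kappa> k + of_real (coeff_err g l \<kappa> k \<epsilon>)) * complex_of_real \<epsilon> ^ (d - k))"
  proof -
    have "S + (\<Sum>k=0..d. (coeff_int g l \<kappa> k + of_real (coeff_err g l \<kappa> k \<epsilon>)) * complex_of_real \<epsilon> ^ (d - k))
        = (\<Sum>k=0..d. of_real (\<kappa> k g * g ^ (d - k)) * D d + of_real (e k * \<epsilon> ^ (d - k)))"
      unfolding S sum.distrib[symmetric]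
      by (intro sum.cong refl) (simp add: coeff_int_def err D_def \<zeta>_def algebra_simps)
    also have "\<dots> = of_real vol * D d + of_real (\<Sum>k=0..d. e k * \<epsilon> ^ (d - k))"
      unfolding vol by (simp add: sum.distrib sum_distrib_right)
    also have "\<dots> = of_real V" unfolding tail by simp
    finally show ?thesis by simp
  qed
  show ?thesis
    using dims main unfolding coeff_total_def d_def V_def by blast
qed

end
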